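(* For all $f,\varphi\in L^2(\mathbb{R}^2,\mathbb{H})$, $$\int_{\mathbb{R}^2}\int_{\mathbb{R}^2}|\mathcal{G}^{\varphi}_{A_1,A_2}\{f\}(\omega,y)|^2\,d\omega\,dy=\|f\|^2_{L^2(\mathbb{R}^2,\mathbb{H})}\,\|\varphi\|^2_{L^2(\mathbb{R}^2,\mathbb{H})}.$$
   Context: $\mathbb{H}$ is the algebra of real quaternions with units $i,j,k$, conjugation $\overline{q}$ and modulus $|q|=\sqrt{q\overline{q}}$. $L^2(\mathbb{R}^2,\mathbb{H})$ is the space of functions $f:\mathbb{R}^2\to\mathbb{H}$ with $\|f\|_{L^2(\mathbb{R}^2,\mathbb{H})}^2=\int_{\mathbb{R}^2}|f(x)|^2dx<\infty$. Fix real $2\times 2$ matrices $A_l=\begin{pmatrix}a_l&b_l\\c_l&d_l\end{pmatrix}$, $l=1,2$, with $a_ld_l-b_lc_l=1$ and $b_1b_2\neq 0$. Kernels: $K^{i}_{A_1}(x_1,\omega_1)=\frac{1}{\sqrt{2\pi b_1}}e^{\frac{i}{2}\left(\frac{a_1}{b_1}x_1^2-\frac{2}{b_1}x_1\omega_1+\frac{d_1}{b_1}\omega_1^2-\frac{\pi}{2}\right)}$ and $K^{j}_{A_2}(x_2,\omega_2)=\frac{1}{\sqrt{2\pi b_2}}e^{\frac{j}{2}\left(\frac{a_2}{b_2}x_2^2-\frac{2}{b_2}x_2\omega_2+\frac{d_2}{b_2}\omega_2^2-\frac{\pi}{2}\right)}$ (for negative $b_1$, resp. $b_2$, the square root is the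 principal one in $\mathbb{R}+\mathbb{R}i$, resp. $\mathbb{R}+\mathbb{R}j$). For a window $\varphi$, the Gabor quaternion linear canonical transform of $f$ is $$\mathcal{G}^{\varphi}_{A_1,A_2}\{f\}(\omega,y)=\int_{\mathbb{R}^2}K^{i}_{A_1}(x_1,\omega_1)f(x)\overline{\varphi(x-y)}K^{j}_{A_2}(x_2,\omega_2)\,dx,\qquad \omega,y\in\mathbb{R}^2.$$ *)

theory Defs
  imports "HOL-Analysis.Analysis"
begin

section \<open>The real algebra of quaternions\<close>

codatatype quat = Quat (qRe: real) (qIm1: real) (qIm2: real) (qIm3: real)

lemma quat_eq_iff:
  "p = q \<longleftrightarrow> qRe p = qRe q \<and> qIm1 p = qIm1 q \<and> qIm2 p = qIm2 q \<and> qIm3 p = qIm3 q"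
  by (auto intro: quat.expand)

instantiation quat :: ab_group_add
begin

primcorec zero_quat where
  "qRe 0 = 0" | "qIm1 0 = 0" | "qIm2 0 = 0" | "qIm3 0 = 0"

primcorec plus_quat where
  "qRe (p + q) = qRe p + qRe q"
| "qIm1 (p + q) = qIm1 p + qIm1 q"
| "qIm2 (p + q) = qIm2 p + qIm2 q"
| "qIm3 (p + q) = qIm3 p + qIm3 q"

primcorec uminus_quat where
  "qRe (- p) = - qRe p"
| "qIm1 (- p) = - qIm1 p"
| "qIm2 (- p) = - qIm2 p"
| "qIm3 (- p) = - qIm3 p"

primcorec minus_quat where
  "qRe (p - q) = qRe p - qRe q"
| "qIm1 (p - q) = qIm1 p - qIm1 q"
| "qIm2 (p - q) = qIm2 p - qIm2 q"
| "qIm3 (p - q) = qIm3 p - qIm3 q"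

instance
  by standard (simp_all add: quat_eq_iff)

end

instantiation quat :: real_algebra_1
begin

primcorec one_quat where
  "qRe 1 = 1" | "qIm1 1 = 0" | "qIm2 1 = 0" | "qIm3 1 = 0"

primcorec times_quat where
  "qRe (p * q) = qRe p * qRe q - qIm1 p * qIm1 q - qIm2 p * qIm2 q - qIm3 p * qIm3 q"
| "qIm1 (p * q) = qRe p * qIm1 q + qIm1 p * qRe q + qIm2 p * qIm3 q - qIm3 p * qIm2 q"
| "qIm2 (p * q) = qRe p * qIm2 q - qIm1 p * qIm3 q + qIm2 p * qRe q + qIm3 p * qIm1 q"
| "qIm3 (p * q) = qRe p * qIm3 q + qIm1 p * qIm2 q - qIm2 p * qIm1 q + qIm3 p * qRe q"

primcorec scaleR_quat where
  "qRe (scaleR r p) = r * qRe p"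
| "qIm1 (scaleR r p) = r * qIm1 p"
| "qIm2 (scaleR r p) = r * qIm2 p"
| "qIm3 (scaleR r p) = r * qIm3 p"

instance
  by standard (simp_all add: quat_eq_iff algebra_simps)

end

instantiation quat :: real_inner
begin

definition inner_quat :: "quat \<Rightarrow> quat \<Rightarrow> real" where
  "inner_quat p q = qRe p * qRe q + qIm1 p * qIm1 q + qIm2 p * qIm2 q + qIm3 p * qIm3 q"

definition norm_quat :: "quat \<Rightarrow> real" where
  "norm_quat p = sqrt ((qRe p)\<^sup>2 + (qIm1 p)\<^sup>2 + (qIm2 p)\<^sup>2 + (qIm3 p)\<^sup>2)"

definition sgn_quat :: "quat \<Rightarrow> quat" where
  "sgn_quat p = p /\<^sub>R norm p"

definition dist_quat :: "quat \<Rightarrow> quat \<Rightarrow> real" where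
  "dist_quat p q = norm (p - q)"

definition uniformity_quat :: "(quat \<times> quat) filter" where
  "uniformity_quat = (INF e\<in>{0 <..}. principal {(p, q). dist p q < e})"

definition open_quat :: "quat set \<Rightarrow> bool" where
  "open_quat U \<longleftrightarrow> (\<forall>p\<in>U. eventually (\<lambda>(p', q). p' = p \<longrightarrow> q \<in> U) uniformity)"

instance
proof
  fix p q s :: quat and r :: real and U :: "quat set"
  show "inner p q = inner q p"
    by (simp add: inner_quat_def mult.commute)
  show "inner (p + q) s = inner p s + inner q s"
    by (simp add: inner_quat_def algebra_simps)
  show "inner (r *\<^sub>R p) q = r * inner p q"
    by (simp add: inner_quat_def algebra_simps)
  show "0 \<le> inner p p"
    by (simp add: inner_quat_def)
  show "inner p p = 0 \<longleftrightarrow> p = 0"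
    by (auto simp: inner_quat_def quat_eq_iff add_nonneg_eq_0_iff)
  show "norm p = sqrt (inner p p)"
    by (simp add: inner_quat_def norm_quat_def power2_eq_square)
qed (simp_all only: sgn_quat_def dist_quat_def uniformity_quat_def open_quat_def)

end

lemma norm_quat_mult: "norm (p * q) = norm p * norm q" for p q :: quat
proof -
  have "(qRe (p * q))\<^sup>2 + (qIm1 (p * q))\<^sup>2 + (qIm2 (p * q))\<^sup>2 + (qIm3 (p * q))\<^sup>2
      = ((qRe p)\<^sup>2 + (qIm1 p)\<^sup>2 + (qIm2 p)\<^sup>2 + (qIm3 p)\<^sup>2)
        * ((qRe q)\<^sup>2 + (qIm1 q)\<^sup>2 + (qIm2 q)\<^sup>2 + (qIm3 q)\<^sup>2)"
    unfolding times_quat.sel by algebra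
  then show ?thesis
    by (simp only: norm_quat_def real_sqrt_mult [symmetric])
qed

instance quat :: real_normed_algebra_1
  by standard (simp_all add: norm_quat_mult, simp add: norm_quat_def)

definition quat_i :: quat where "quat_i = Quat 0 1 0 0"
definition quat_j :: quat where "quat_j = Quat 0 0 1 0"
definition quat_k :: quat where "quat_k = Quat 0 0 0 1"

lemma quat_unit_sel [simp]:
  "qRe quat_i = 0" "qIm1 quat_i = 1" "qIm2 quat_i = 0" "qIm3 quat_i = 0"
  "qRe quat_j = 0" "qIm1 quat_j = 0" "qIm2 quat_j = 1" "qIm3 quat_j = 0"
  "qRe quat_k = 0" "qIm1 quat_k = 0" "qIm2 quat_k = 0" "qIm3 quat_k = 1"
  by (simp_all add: quat_i_def quat_j_def quat_k_def)

lemma quat_unit_mult: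
  "quat_i * quat_i = -1" "quat_j * quat_j = -1" "quat_k * quat_k = -1"
  "quat_i * quat_j = quat_k" "quat_j * quat_k = quat_i" "quat_k * quat_i = quat_j"
  "quat_j * quat_i = - quat_k" "quat_k * quat_j = - quat_i" "quat_i * quat_k = - quat_j"
  by (simp_all add: quat_eq_iff)

text \<open>The Euclidean structure makes the Bochner integral and \<^const>\<open>exp\<close> available on \<^typ>\<open>quat\<close>.\<close>

instantiation quat :: euclidean_space
begin

definition Basis_quat :: "quat set" where
  "Basis_quat = {1, quat_i, quat_j, quat_k}"

instance
proof
  show "(Basis :: quat set) \<noteq> {}" "finite (Basis :: quat set)"
    by (simp_all add: Basis_quat_def)
  show "inner u v = (if u = v then 1 else 0)" if "u \<in> Basis" "v \<in> Basis" for u v :: quat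
    using that unfolding Basis_quat_def
    by (elim insertE emptyE; simp add: inner_quat_def quat_eq_iff)
  show "(\<forall>u\<in>Basis. inner p u = 0) \<longleftrightarrow> p = 0" for p :: quat
    by (simp only: Basis_quat_def ball_simps(5,7) simp_thms) (simp add: inner_quat_def quat_eq_iff)
qed

end

primcorec qcnj :: "quat \<Rightarrow> quat" where
  "qRe (qcnj q) = qRe q"
| "qIm1 (qcnj q) = - qIm1 q"
| "qIm2 (qcnj q) = - qIm2 q"
| "qIm3 (qcnj q) = - qIm3 q"

lemma mult_qcnj: "q * qcnj q = of_real ((norm q)\<^sup>2)"
  by (simp add: quat_eq_iff norm_quat_def of_real_def power2_eq_square)


section \<open>Square-integrable quaternion-valued functions\<close>

definition L2_quat :: "(real^2 \<Rightarrow> quat) set" where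
  "L2_quat = {f. f \<in> borel_measurable lebesgue \<and> integrable lebesgue (\<lambda>x. (norm (f x))\<^sup>2)}"

definition L2_norm_quat :: "(real^2 \<Rightarrow> quat) \<Rightarrow> real" where
  "L2_norm_quat f = sqrt (integral\<^sup>L lebesgue (\<lambda>x. (norm (f x))\<^sup>2))"


section \<open>The Gabor quaternion linear canonical transform\<close>

text \<open>For \<open>\<mu>\<^sup>2 = -1\<close>, this identifies the complex numbers with the subfield
  \<open>\<real> + \<real>\<mu>\<close> of the quaternions.  It transports the principal square root \<^const>\<open>csqrt\<close>,
  which is needed when the radicand \<open>2\<pi>b\<close> is negative.\<close>

definition quat_of_complex :: "quat \<Rightarrow> complex \<Rightarrow> quat" where
  "quat_of_complex \<mu> z = of_real (Re z) + Im z *\<^sub>R \<mu>"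

lemma quat_of_complex_mult:
  assumes "\<mu> * \<mu> = -1"
  shows "quat_of_complex \<mu> (z * w) = quat_of_complex \<mu> z * quat_of_complex \<mu> w"
proof -
  have "quat_of_complex \<mu> z * quat_of_complex \<mu> w
      = of_real (Re z * Re w) + (Re z * Im w + Im z * Re w) *\<^sub>R \<mu> + (Im z * Im w) *\<^sub>R (\<mu> * \<mu>)"
    by (simp add: quat_of_complex_def of_real_def distrib_left distrib_right scaleR_add_left scaleR_add_right mult_ac add_ac)
  then show ?thesis
    by (simp add: assms quat_of_complex_def of_real_def scaleR_diff_left)
qed

text \<open>The kernel \<open>K\<^sup>\<mu>\<^sub>A\<close> for \<open>\<mu> \<in> {quat_i, quat_j}\<close>.
  The summand \<open>-\<pi>/2\<close> is part of the factor multiplied by \<open>\<mu>/2\<close>.\<close>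

definition lct_kernel :: "quat \<Rightarrow> real^2^2 \<Rightarrow> real \<Rightarrow> real \<Rightarrow> quat" where
  "lct_kernel \<mu> A x \<omega> =
    (let a = A$1$1; b = A$1$2; d = A$2$2
     in quat_of_complex \<mu> (1 / csqrt (complex_of_real (2 * pi * b)))
        * exp (((a / b * x\<^sup>2 - 2 / b * x * \<omega> + d / b * \<omega>\<^sup>2 - pi / 2) / 2) *\<^sub>R \<mu>))"

definition gabor_qlct ::
  "real^2^2 \<Rightarrow> real^2^2 \<Rightarrow> (real^2 \<Rightarrow> quat) \<Rightarrow> (real^2 \<Rightarrow> quat) \<Rightarrow> real^2 \<Rightarrow> real^2 \<Rightarrow> quat" where
  "gabor_qlct A\<^sub>1 A\<^sub>2 \<phi> f \<omega> y =
    integral\<^sup>L lebesgue (\<lambda>x.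
      lct_kernel quat_i A\<^sub>1 (x$1) (\<omega>$1) * f x * qcnj (\<phi> (x - y)) * lct_kernel quat_j A\<^sub>2 (x$2) (\<omega>$2))"

end

(*
  For fixed y the transform is the quaternionic linear canonical transform of
  h_y(x) = f(x) cnj(phi(x - y)), so by Tonelli everything reduces to the Plancherel identity of that
  transform for h in L^1 and L^2 (h_y is in L^1 for every y, and in L^2 for almost every y).

  The eigenspaces of the involution q -> i q j diagonalise the two-sided multiplication: on them
  e^{i s} q e^{j t} acts as multiplication by e^{i (s - t)} or e^{i (s + t)}. The quaternionic transform thus
  splits into two complex Fourier transforms, up to unimodular chirps and a diagonal change of variables.

  The complex Plancherel identity is obtained by Gaussian summation: |F h|^2 is the Fourier
  transform of the autocorrelation r of h, hence the integral of |F h(w)|^2 gauss(e w) equals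
  (2 pi)^(n/2) times the integral of r(e u) gauss(u); let e -> 0.
*)

theory Submission
  imports Defs "HOL-Probability.Characteristic_Functions"
begin

section \<open>Continuity of translation in \<open>L\<^sup>1\<close>\<close>

text \<open>Letting e tend to 0 requires continuity of the autocorrelation at 0, which is extracted
  from continuity of translation in L^1. Square integrability of the transform is not known
  beforehand, so Plancherel is stated with nonnegative integrals: the Gaussian weights increase to
  1, monotone convergence acts on that side and dominated convergence on the other. A product of two
  L^2 functions always lies in L^1, which makes the transform a genuine integral; its square
  integrability comes only from Tonelli in y. The constants cancel exactly: the kernels contribute 1
  / ((2 pi)^2 |b1 b2|), Plancherel in the plane (2 pi)^2, the diagonal substitution |b1 b2|. The two
  eigenspaces are orthogonal, so the two complex identities add up. Members of
  \<open>L2_quat\<close> are only Lebesgue measurable, hence Borel representatives are substituted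
  before Tonelli is applied.\<close>

lemma ennreal_tendsto_0I:
  fixes f :: "'a \<Rightarrow> ennreal"
  assumes "\<And>e::real. e > 0 \<Longrightarrow> eventually (\<lambda>n. f n \<le> ennreal e) F"
  shows "(f \<longlongrightarrow> 0) F"
proof (rule order_tendstoI)
  fix a :: ennreal assume "0 < a"
  then obtain b where b: "0 < b" "b < a" using dense by blast
  then obtain e where "b = ennreal e" by (cases b) auto
  with b have e: "0 < ennreal e" "ennreal e < a" by auto
  then have "e > 0" by simp
  from assms[OF this] e show "eventually (\<lambda>n. f n < a) F"
    by (auto elim!: eventually_mono)
qed simp

lemma nn_integral_lborel_translation:
  fixes g :: "'a::euclidean_space \<Rightarrow> ennreal"
  assumes [measurable]: "g \<in> borel_measurable borel"
  shows "(\<integral>\<^sup>+x. g (x - v) \<partial>lborel) = (\<integral>\<^sup>+x. g x \<partial>lborel)"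
proof -
  have "(\<integral>\<^sup>+x. g x \<partial>lborel) = (\<integral>\<^sup>+x. g x \<partial>distr lborel borel ((+) (-v)))"
    by (simp only: lborel_distr_plus)
  also have "\<dots> = (\<integral>\<^sup>+x. g (x - v) \<partial>lborel)"
    by (subst nn_integral_distr) simp_all
  finally show ?thesis ..
qed

lemma lborel_distr_reflection:
  fixes v :: "'a::euclidean_space"
  shows "distr lborel borel (\<lambda>x. v - x) = lborel"
  using lborel_affine[of "-1" v] by (simp add: density_1)

text \<open>The property passes to L^1 limits: translation preserves L^1 distance, so replacing both
  \<open>f\<close> and its translate by those of \<open>g\<close> costs e/3 each. The approximant
  may depend on \<open>e\<close>, which serves both outer regularity and the limit step of the
  induction below.\<close>

lemma translation_continuous_L1_approx:
  fixes f :: "'a::euclidean_space \<Rightarrow> 'b::{banach, second_countable_topology}" and v :: "nat \<Rightarrow> 'a"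
  assumes [measurable]: "f \<in> borel_measurable borel"
    and app: "\<And>e::real. e > 0 \<Longrightarrow> \<exists>g\<in>borel_measurable borel.
        (\<integral>\<^sup>+x. ennreal (norm (f x - g x)) \<partial>lborel) \<le> ennreal e \<and>
        (\<lambda>n. \<integral>\<^sup>+x. ennreal (norm (g (x - v n) - g x)) \<partial>lborel) \<longlonglongrightarrow> 0"
  shows "(\<lambda>n. \<integral>\<^sup>+x. ennreal (norm (f (x - v n) - f x)) \<partial>lborel) \<longlonglongrightarrow> 0"
proof (rule ennreal_tendsto_0I)
  fix e :: real assume "e > 0"
  then obtain g where [measurable]: "g \<in> borel_measurable borel"
    and d: "(\<integral>\<^sup>+x. ennreal (norm (f x - g x)) \<partial>lborel) \<le> ennreal (e/3)"
    and lim: "(\<lambda>n. \<integral>\<^sup>+x. ennreal (norm (g (x - v n) - g x)) \<partial>lborel) \<longlonglongrightarrow> 0"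
    using app[of "e/3"] by auto
  have "eventually (\<lambda>n. (\<integral>\<^sup>+x. ennreal (norm (g (x - v n) - g x)) \<partial>lborel) < ennreal (e/3)) sequentially"
    using \<open>e > 0\<close> by (intro order_tendstoD(2)[OF lim]) simp
  then show "eventually (\<lambda>n. (\<integral>\<^sup>+x. ennreal (norm (f (x - v n) - f x)) \<partial>lborel) \<le> ennreal e) sequentially"
  proof eventually_elim
    case (elim n)
    have "(\<integral>\<^sup>+x. ennreal (norm (f (x - v n) - f x)) \<partial>lborel) \<le>
       (\<integral>\<^sup>+x. ennreal (norm (f (x - v n) - g (x - v n))) + ennreal (norm (g (x - v n) - g x)) + ennreal (norm (f x - g x)) \<partial>lborel)"
    proof (rule nn_integral_mono)
      fix x
      have "norm (f (x - v n) - f x) \<le> norm (f (x - v n) - g (x - v n)) + norm (g (x - v n) - g x) + norm (f x - g x)"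
        by norm
      then show "ennreal (norm (f (x - v n) - f x)) \<le> ennreal (norm (f (x - v n) - g (x - v n))) + ennreal (norm (g (x - v n) - g x)) + ennreal (norm (f x - g x))"
        by (simp flip: ennreal_plus)
    qed
    also have "\<dots> = (\<integral>\<^sup>+x. ennreal (norm (f (x - v n) - g (x - v n))) \<partial>lborel)
        + (\<integral>\<^sup>+x. ennreal (norm (g (x - v n) - g x)) \<partial>lborel) + (\<integral>\<^sup>+x. ennreal (norm (f x - g x)) \<partial>lborel)"
      by (subst nn_integral_add, simp, simp)+ simp
    also have "(\<integral>\<^sup>+x. ennreal (norm (f (x - v n) - g (x - v n))) \<partial>lborel) = (\<integral>\<^sup>+x. ennreal (norm (f x - g x)) \<partial>lborel)"
      by (rule nn_integral_lborel_translation[where g="\<lambda>x. ennreal (norm (f x - g x))"]) simp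
    also have "\<dots> + (\<integral>\<^sup>+x. ennreal (norm (g (x - v n) - g x)) \<partial>lborel) + (\<integral>\<^sup>+x. ennreal (norm (f x - g x)) \<partial>lborel)
       \<le> ennreal (e/3) + ennreal (e/3) + ennreal (e/3)"
      using d elim by (intro add_mono) auto
    also have "\<dots> = ennreal e"
      using \<open>e > 0\<close> by (simp flip: ennreal_plus)
    finally show ?case .
  qed
qed

text \<open>
  Openness gives \<open>U - (U + v) \<rightarrow> \<emptyset>\<close> pointwise as \<open>v \<rightarrow> 0\<close>; the boundary of \<open>U\<close>, which may
  have positive measure, only matters for \<open>(U + v) - U\<close>, a set of the same measure.
\<close>

lemma translation_continuous_L1_open:
  fixes U :: "'a::euclidean_space set" and c :: "'b::{banach, second_countable_topology}"
  assumes "open U" and fin: "emeasure lborel U < \<infinity>" and v: "v \<longlonglongrightarrow> 0"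
  shows "(\<lambda>n. \<integral>\<^sup>+x. ennreal (norm (indicator U (x - v n) *\<^sub>R c - indicator U x *\<^sub>R c)) \<partial>lborel) \<longlonglongrightarrow> 0"
proof -
  have [measurable]: "U \<in> sets borel" using \<open>open U\<close> by simp
  have fm: "U \<in> fmeasurable lborel" using fin by (simp add: fmeasurable_def)
  let ?i = "\<lambda>x. indicator U x :: real"
  have "(\<lambda>n. \<integral>\<^sup>+x. ennreal (norm (?i (x - v n) - ?i x)) \<partial>lborel) \<longlonglongrightarrow> 0"
  proof -
    have a: "(\<lambda>n. \<integral>\<^sup>+x. ennreal (?i x * (1 - ?i (x - v n))) \<partial>lborel) \<longlonglongrightarrow> (\<integral>\<^sup>+x. 0 \<partial>(lborel::'a measure))"
    proof (rule nn_integral_dominated_convergence[where w="\<lambda>x. ennreal (?i x)"])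
      show "(\<integral>\<^sup>+x. ennreal (?i x) \<partial>lborel) < \<infinity>"
        using fin by (simp add: ennreal_indicator)
      show "AE x in lborel. (\<lambda>n. ennreal (?i x * (1 - ?i (x - v n)))) \<longlonglongrightarrow> 0"
      proof (rule AE_I2)
        fix x
        show "(\<lambda>n. ennreal (?i x * (1 - ?i (x - v n)))) \<longlonglongrightarrow> 0"
        proof (cases "x \<in> U")
          case True
          have "(\<lambda>n. x - v n) \<longlonglongrightarrow> x - 0" by (intro tendsto_intros v)
          then have "eventually (\<lambda>n. x - v n \<in> U) sequentially"
            using topological_tendstoD[OF _ \<open>open U\<close>] True by fastforce
          then show ?thesis
            using True by (intro tendsto_eventually) (auto elim!: eventually_mono)
        qed simp
      qed
    qed (auto simp: indicator_def)
    have eq: "(\<integral>\<^sup>+x. ennreal (norm (?i (x - v n) - ?i x)) \<partial>lborel) = 2 * (\<integral>\<^sup>+x. ennreal (?i x * (1 - ?i (x - v n))) \<partial>lborel)" for n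
    proof -
      let ?S = "{x. x - v n \<in> U}"
      have [measurable]: "?S \<in> sets borel" by measurable
      have S: "emeasure lborel ?S = emeasure lborel U"
        using nn_integral_lborel_translation[of "indicator U" "v n"]
        by (simp flip: nn_integral_indicator add: indicator_def[abs_def])
      have D: "emeasure lborel (A - B) = emeasure lborel A - emeasure lborel (A \<inter> B)"
        if [measurable]: "A \<in> sets borel" "B \<in> sets borel" and "emeasure lborel A < \<infinity>" for A B :: "'a set"
      proof -
        have "emeasure lborel (A \<inter> B) \<le> emeasure lborel A" by (intro emeasure_mono) auto
        also note \<open>emeasure lborel A < \<infinity>\<close>
        finally have "emeasure lborel (A - A \<inter> B) = emeasure lborel A - emeasure lborel (A \<inter> B)"
          by (intro emeasure_Diff) auto
        also have "A - A \<inter> B = A - B" by blast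
        finally show ?thesis .
      qed
      have D1: "emeasure lborel (?S - U) = emeasure lborel (U - ?S)"
        using fin by (simp add: D S Int_commute)
      have "(\<integral>\<^sup>+x. ennreal (norm (?i (x - v n) - ?i x)) \<partial>lborel) = (\<integral>\<^sup>+x. indicator (?S - U) x + indicator (U - ?S) x \<partial>lborel)"
        by (intro nn_integral_cong) (auto simp: indicator_def)
      also have "\<dots> = emeasure lborel (?S - U) + emeasure lborel (U - ?S)"
        by (subst nn_integral_add) auto
      also have "emeasure lborel (U - ?S) = (\<integral>\<^sup>+x. ennreal (?i x * (1 - ?i (x - v n))) \<partial>lborel)"
      proof -
        have "emeasure lborel (U - ?S) = (\<integral>\<^sup>+x. indicator (U - ?S) x \<partial>lborel)" by simp
        also have "\<dots> = (\<integral>\<^sup>+x. ennreal (?i x * (1 - ?i (x - v n))) \<partial>lborel)"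
          by (intro nn_integral_cong) (auto simp: indicator_def)
        finally show ?thesis .
      qed
      finally show ?thesis using D1 by (simp add: mult_2 \<open>emeasure lborel (U - ?S) = _\<close>)
    qed
    have "(\<lambda>n. 2 * (\<integral>\<^sup>+x. ennreal (?i x * (1 - ?i (x - v n))) \<partial>lborel)) \<longlonglongrightarrow> 2 * 0"
      using a by (intro ennreal_tendsto_cmult) auto
    then show ?thesis unfolding eq by simp
  qed
  then have "(\<lambda>n. ennreal (norm c) * (\<integral>\<^sup>+x. ennreal (norm (?i (x - v n) - ?i x)) \<partial>lborel)) \<longlonglongrightarrow> ennreal (norm c) * 0"
    by (intro ennreal_tendsto_cmult) auto
  moreover have "ennreal (norm (indicator U (x - v n) *\<^sub>R c - indicator U x *\<^sub>R c)) = ennreal (norm c) * ennreal (norm (?i (x - v n) - ?i x))" for x n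
    by (simp flip: ennreal_mult scaleR_diff_left add: mult.commute)
  ultimately show ?thesis
    by (simp add: nn_integral_cmult)
qed

text \<open>Induction on integrable functions: an indicator is approximated in L^1 by that of an
  open superset, sums obey the triangle inequality, and dominated pointwise limits are L^1
  limits.\<close>

theorem translation_continuous_L1:
  fixes f :: "'a::euclidean_space \<Rightarrow> 'b::{banach, second_countable_topology}"
  assumes "integrable lborel f" and v: "v \<longlonglongrightarrow> 0"
  shows "(\<lambda>n. \<integral>\<^sup>+x. ennreal (norm (f (x - v n) - f x)) \<partial>lborel) \<longlonglongrightarrow> 0"
  using assms(1)
proof (induction rule: integrable_induct)
  case (base A c)
  have [measurable]: "A \<in> sets borel" using base by simp
  show ?case
  proof (rule translation_continuous_L1_approx)
    fix e :: real assume e: "e > 0"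
    \<comment> \<open>The summand 1 covers \<open>c = 0\<close>.\<close>
    define d where "d = e / (norm c + 1)"
    have c: "norm c + 1 > 0" by (simp add: add_nonneg_pos)
    have d: "d > 0" "d * norm c \<le> e" using e c
      by (auto simp: d_def field_simps)
    obtain U where U: "open U" "A \<subseteq> U" "emeasure lborel (U - A) < d"
      using outer_regular_lborel[of A d] d by auto
    have [measurable]: "U \<in> sets borel" using U by simp
    have "emeasure lborel U = emeasure lborel (A \<union> (U - A))"
      using U by (intro arg_cong2[where f=emeasure]) auto
    also have "\<dots> \<le> emeasure lborel A + emeasure lborel (U - A)"
      by (intro emeasure_subadditive) auto
    also have "\<dots> < \<infinity>" using base U by (auto intro: less_trans)
    finally have fin: "emeasure lborel U < \<infinity>" .
    show "\<exists>g\<in>borel_measurable borel.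
        (\<integral>\<^sup>+x. ennreal (norm (indicator A x *\<^sub>R c - g x)) \<partial>lborel) \<le> ennreal e \<and>
        (\<lambda>n. \<integral>\<^sup>+x. ennreal (norm (g (x - v n) - g x)) \<partial>lborel) \<longlonglongrightarrow> 0"
    proof (intro bexI conjI)
      have "(\<integral>\<^sup>+x. ennreal (norm (indicator A x *\<^sub>R c - indicator U x *\<^sub>R c)) \<partial>lborel)
         = (\<integral>\<^sup>+x. ennreal (norm c) * indicator (U - A) x \<partial>lborel)"
        using U by (intro nn_integral_cong) (auto simp: indicator_def)
      also have "\<dots> = ennreal (norm c) * emeasure lborel (U - A)"
        by (simp add: nn_integral_cmult)
      also have "\<dots> \<le> ennreal (norm c) * ennreal d"
        using U by (intro mult_left_mono) auto
      also have "\<dots> \<le> ennreal e" using d by (simp flip: ennreal_mult add: mult.commute ennreal_leI)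
      finally show "(\<integral>\<^sup>+x. ennreal (norm (indicator A x *\<^sub>R c - indicator U x *\<^sub>R c)) \<partial>lborel) \<le> ennreal e" .
    qed (use translation_continuous_L1_open[OF U(1) fin v] in auto)
  qed simp
next
  case (add f g)
  have [measurable]: "f \<in> borel_measurable borel" "g \<in> borel_measurable borel"
    using add by (auto dest: borel_measurable_integrable)
  show ?case
  proof (rule tendsto_sandwich[OF _ _ tendsto_const])
    show "(\<lambda>n. (\<integral>\<^sup>+x. ennreal (norm (f (x - v n) - f x)) \<partial>lborel) + (\<integral>\<^sup>+x. ennreal (norm (g (x - v n) - g x)) \<partial>lborel)) \<longlonglongrightarrow> 0"
      using tendsto_add[OF add(3,4)] by simp
    show "\<forall>\<^sub>F n in sequentially. (\<integral>\<^sup>+x. ennreal (norm (f (x - v n) + g (x - v n) - (f x + g x))) \<partial>lborel) \<le> 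
       (\<integral>\<^sup>+x. ennreal (norm (f (x - v n) - f x)) \<partial>lborel) + (\<integral>\<^sup>+x. ennreal (norm (g (x - v n) - g x)) \<partial>lborel)"
    proof (intro always_eventually allI)
      fix n
      show "(\<integral>\<^sup>+x. ennreal (norm (f (x - v n) + g (x - v n) - (f x + g x))) \<partial>lborel) \<le> 
       (\<integral>\<^sup>+x. ennreal (norm (f (x - v n) - f x)) \<partial>lborel) + (\<integral>\<^sup>+x. ennreal (norm (g (x - v n) - g x)) \<partial>lborel)"
        by (subst nn_integral_add[symmetric])
           (auto intro!: nn_integral_mono norm_diff_triangle_ineq simp flip: ennreal_plus)
    qed
  qed simp
next
  case (lim f s)
  have [measurable]: "f \<in> borel_measurable borel" "s i \<in> borel_measurable borel" for i
    using lim by (auto dest: borel_measurable_integrable)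
  show ?case
  proof (rule translation_continuous_L1_approx)
    fix e :: real assume e: "e > 0"
    have "(\<lambda>i. \<integral>\<^sup>+x. ennreal (norm (f x - s i x)) \<partial>lborel) \<longlonglongrightarrow> (\<integral>\<^sup>+x. 0 \<partial>(lborel::'a measure))"
    \<comment> \<open>The approximants satisfy |s i x| \<le> 2 |f x|, hence the constant 3.\<close>
    proof (rule nn_integral_dominated_convergence[where w="\<lambda>x. ennreal (3 * norm (f x))"])
      show "(\<integral>\<^sup>+ x. ennreal (3 * norm (f x)) \<partial>lborel) < \<infinity>"
        using lim(4) by (auto simp: integrable_iff_bounded ennreal_mult nn_integral_cmult ennreal_mult_less_top)
      show "AE x in lborel. (\<lambda>i. ennreal (norm (f x - s i x))) \<longlonglongrightarrow> 0"
      proof (rule AE_I2)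
        fix x
        have "(\<lambda>i. norm (f x - s i x)) \<longlonglongrightarrow> norm (f x - f x)"
          using lim(2)[of x] by (intro tendsto_intros) auto
        then show "(\<lambda>i. ennreal (norm (f x - s i x))) \<longlonglongrightarrow> 0"
          by (simp add: tendsto_ennrealI[where x=0, simplified])
      qed
      show "AE x in lborel. ennreal (norm (f x - s i x)) \<le> ennreal (3 * norm (f x))" for i
      proof (rule AE_I2)
        fix x
        have "norm (f x - s i x) \<le> norm (f x) + norm (s i x)" by (rule norm_triangle_ineq4)
        with lim(3)[of x i] show "ennreal (norm (f x - s i x)) \<le> ennreal (3 * norm (f x))"
          by (intro ennreal_leI) auto
      qed
    qed auto
    then have "eventually (\<lambda>i. (\<integral>\<^sup>+x. ennreal (norm (f x - s i x)) \<partial>lborel) < ennreal e) sequentially"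
      using e by (intro order_tendstoD(2)) auto
    then obtain i where "(\<integral>\<^sup>+x. ennreal (norm (f x - s i x)) \<partial>lborel) < ennreal e"
      by (auto simp: eventually_sequentially)
    then show "\<exists>g\<in>borel_measurable borel.
        (\<integral>\<^sup>+x. ennreal (norm (f x - g x)) \<partial>lborel) \<le> ennreal e \<and>
        (\<lambda>n. \<integral>\<^sup>+x. ennreal (norm (g (x - v n) - g x)) \<partial>lborel) \<longlonglongrightarrow> 0"
      using lim(5)[of i] by (intro bexI[of _ "s i"]) auto
  qed simp
qed

section \<open>The Gaussian\<close>

text \<open>\<open>lborel\<close> is the image of the product of one-dimensional Lebesgue measures
  under the coordinate map, and there product functions integrate to products.\<close>

lemma
  fixes f :: "'a::euclidean_space \<Rightarrow> real \<Rightarrow> complex"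
  assumes int: "\<And>b. b \<in> Basis \<Longrightarrow> integrable lborel (f b)"
  shows integrable_lborel_prod: "integrable lborel (\<lambda>x. \<Prod>b\<in>Basis. f b (x \<bullet> b))"
    and integral_lborel_prod: "(\<integral>x. (\<Prod>b\<in>Basis. f b (x \<bullet> b)) \<partial>lborel) = (\<Prod>b\<in>Basis. integral\<^sup>L lborel (f b))"
proof -
  interpret product_sigma_finite "\<lambda>_::'a. lborel :: real measure" ..
  have [measurable]: "b \<in> Basis \<Longrightarrow> f b \<in> borel_measurable borel" for b
    using int[THEN borel_measurable_integrable] by simp
  let ?P = "\<Pi>\<^sub>M b\<in>(Basis::'a set). (lborel :: real measure)"
  have F[measurable]: "(\<lambda>x::'a. \<Prod>b\<in>Basis. f b (x \<bullet> b)) \<in> borel_measurable borel"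
    by measurable
  have T[measurable]: "(\<lambda>g. \<Sum>b\<in>Basis. g b *\<^sub>R b) \<in> ?P \<rightarrow>\<^sub>M (borel :: 'a measure)"
    by measurable
  have eq: "(\<Prod>b\<in>Basis. f b ((\<Sum>c\<in>Basis. g c *\<^sub>R c) \<bullet> b)) = (\<Prod>b\<in>Basis. f b (g b))" for g :: "'a \<Rightarrow> real"
    by (intro prod.cong) simp_all
  show "integrable lborel (\<lambda>x. \<Prod>b\<in>Basis. f b (x \<bullet> b))"
    by (subst lborel_eq, subst integrable_distr_eq[OF T F])
       (simp add: eq product_integrable_prod int)
  show "(\<integral>x. (\<Prod>b\<in>Basis. f b (x \<bullet> b)) \<partial>lborel) = (\<Prod>b\<in>Basis. integral\<^sup>L lborel (f b))"
    by (subst lborel_eq, subst integral_distr[OF T F])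
       (simp add: eq product_integral_prod int)
qed

text \<open>Normalised to the value 1 at the origin rather than to mass 1, so that its dilates tend
  to 1 as the scale tends to 0.\<close>

definition gauss :: "'a::euclidean_space \<Rightarrow> real" where
  "gauss x = exp (- (norm x)\<^sup>2 / 2)"

text \<open>Without a normalising factor, so Plancherel carries (2 pi)^n. For non-integrable
  \<open>h\<close> the Bochner integral takes its default value 0.\<close>

definition fourier :: "('a::euclidean_space \<Rightarrow> complex) \<Rightarrow> 'a \<Rightarrow> complex" where
  "fourier h w = (\<integral>x. cis (- (x \<bullet> w)) * h x \<partial>lborel)"

lemma gauss_measurable [measurable]: "gauss \<in> borel_measurable borel"
  unfolding gauss_def by measurable

lemma gauss_nonneg: "gauss x \<ge> 0" and gauss_0 [simp]: "gauss 0 = 1"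
  by (simp_all add: gauss_def)

text \<open>Inner product and squared norm are both sums over coordinates; the factorisation reduces
  the transform of the Gaussian to dimension one.\<close>

lemma gauss_eq_prod:
  fixes x w :: "'a::euclidean_space"
  shows "cis (- (x \<bullet> w)) * of_real (gauss x) =
     (\<Prod>b\<in>Basis. cis (- ((x \<bullet> b) * (w \<bullet> b))) * of_real (gauss (x \<bullet> b)))"
proof -
  have "cis (- (x \<bullet> w)) = (\<Prod>b\<in>Basis. cis (- ((x \<bullet> b) * (w \<bullet> b))))"
    by (subst euclidean_inner) (simp add: cis_conv_exp exp_sum sum_distrib_left flip: sum_negf)
  moreover have "(norm x)\<^sup>2 = (\<Sum>b\<in>Basis. (x \<bullet> b)\<^sup>2)"
    by (subst power2_norm_eq_inner, subst euclidean_inner) (simp add: power2_eq_square)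
  then have "gauss x = (\<Prod>b\<in>Basis. gauss (x \<bullet> b))"
    by (simp add: gauss_def exp_sum[symmetric] sum_divide_distrib sum_negf)
  ultimately show ?thesis
    by (simp add: prod.distrib)
qed

lemma cis_measurable [measurable]: "cis \<in> borel_measurable borel"
  by (intro borel_measurable_continuous_onI continuous_intros)

text \<open>Up to the factor \<open>sqrt (2 * pi)\<close>, \<open>gauss\<close> is the standard
  normal density, whose characteristic function is again a Gaussian.\<close>

lemma
  fixes w :: real
  shows integrable_gauss_real: "integrable lborel (\<lambda>x. cis (- (x * w)) * of_real (gauss x))"
    and fourier_gauss_real: "(\<integral>x. cis (- (x * w)) * of_real (gauss x) \<partial>lborel) = of_real (sqrt (2 * pi) * gauss w)"
proof -
  have g: "gauss x = sqrt (2 * pi) * std_normal_density x" for x :: real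
    by (simp add: gauss_def std_normal_density_def)
  have "integrable lborel (gauss :: real \<Rightarrow> real)"
    unfolding g using integrable_normal_density[of 1 0] by simp
  then show "integrable lborel (\<lambda>x. cis (- (x * w)) * of_real (gauss x))"
    by (rule Bochner_Integration.integrable_bound) (auto simp: norm_mult gauss_nonneg)
  have "of_real (gauss w) = char std_normal_distribution (- w)"
    by (simp add: char_std_normal_distribution gauss_def)
  also have "\<dots> = (\<integral>x. std_normal_density x *\<^sub>R iexp (- w * x) \<partial>lborel)"
    unfolding char_def by (subst integral_density) auto
  finally have *: "of_real (gauss w) = \<dots>" .
  have "(\<integral>x. cis (- (x * w)) * of_real (gauss x) \<partial>lborel) =
     (\<integral>x. of_real (sqrt (2 * pi)) * (std_normal_density x *\<^sub>R iexp (- w * x)) \<partial>lborel)"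
    by (intro Bochner_Integration.integral_cong) (auto simp: g cis_conv_exp scaleR_conv_of_real mult_ac)
  also have "\<dots> = of_real (sqrt (2 * pi) * gauss w)"
    by (simp only: * integral_mult_right_zero of_real_mult)
  finally show "(\<integral>x. cis (- (x * w)) * of_real (gauss x) \<partial>lborel) = of_real (sqrt (2 * pi) * gauss w)" .
qed

lemma
  fixes w :: "'a::euclidean_space"
  shows integrable_cis_gauss: "integrable lborel (\<lambda>x. cis (- (x \<bullet> w)) * of_real (gauss x))"
    and fourier_gauss: "fourier (\<lambda>x. of_real (gauss x)) w = of_real (sqrt (2 * pi) ^ DIM('a) * gauss w)"
proof -
  show "integrable lborel (\<lambda>x. cis (- (x \<bullet> w)) * of_real (gauss x))"
    unfolding gauss_eq_prod
    by (rule integrable_lborel_prod[where f="\<lambda>b t. cis (- (t * (w \<bullet> b))) * of_real (gauss t)"])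
       (rule integrable_gauss_real)
  have "fourier (\<lambda>x. of_real (gauss x)) w = (\<Prod>b\<in>Basis. of_real (sqrt (2 * pi) * gauss (w \<bullet> b)))"
    unfolding fourier_def gauss_eq_prod
    by (subst integral_lborel_prod[where f="\<lambda>b t. cis (- (t * (w \<bullet> b))) * of_real (gauss t)"])
       (simp_all only: integrable_gauss_real fourier_gauss_real)
  also have "\<dots> = of_real (sqrt (2 * pi) ^ DIM('a) * gauss w)"
    \<comment> \<open>At frequency 0 the product formula is the factorisation of
      \<open>gauss w\<close> itself.\<close>
    using gauss_eq_prod[of w 0] by (simp add: prod.distrib)
  finally show "fourier (\<lambda>x. of_real (gauss x)) w = of_real (sqrt (2 * pi) ^ DIM('a) * gauss w)" .
qed

lemma integrable_gauss: "integrable lborel (gauss :: 'a::euclidean_space \<Rightarrow> real)"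
  using integrable_cis_gauss[of "0::'a"] by (simp add: complex_of_real_integrable_eq)

lemma integral_gauss: "(\<integral>x. gauss (x::'a::euclidean_space) \<partial>lborel) = sqrt (2 * pi) ^ DIM('a)"
proof -
  have "complex_of_real (\<integral>x. gauss (x::'a) \<partial>lborel) = of_real (sqrt (2 * pi) ^ DIM('a))"
    using fourier_gauss[of "0::'a"] by (simp add: fourier_def)
  then show ?thesis by (simp only: of_real_eq_iff)
qed

section \<open>Fourier transform and autocorrelation\<close>

lemma
  fixes g :: "'a::euclidean_space \<Rightarrow> 'b::{banach, second_countable_topology}"
  assumes [measurable]: "g \<in> borel_measurable borel"
  shows integral_lborel_reflection: "(\<integral>x. g (v - x) \<partial>lborel) = (\<integral>x. g x \<partial>lborel)"
    and integrable_lborel_reflection: "integrable lborel (\<lambda>x. g (v - x)) \<longleftrightarrow> integrable lborel g"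
proof -
  have [measurable]: "(\<lambda>x. v - x) \<in> lborel \<rightarrow>\<^sub>M borel" by simp
  show "(\<integral>x. g (v - x) \<partial>lborel) = (\<integral>x. g x \<partial>lborel)"
    by (subst (2) lborel_distr_reflection[of v, symmetric], subst integral_distr) simp_all
  show "integrable lborel (\<lambda>x. g (v - x)) \<longleftrightarrow> integrable lborel g"
    by (subst (2) lborel_distr_reflection[of v, symmetric], subst integrable_distr_eq) simp_all
qed

lemma
  fixes g :: "'a::euclidean_space \<Rightarrow> 'b::{banach, second_countable_topology}"
  assumes [measurable]: "g \<in> borel_measurable borel"
  shows integral_lborel_translation: "(\<integral>x. g (x - v) \<partial>lborel) = (\<integral>x. g x \<partial>lborel)"
    and integrable_lborel_translation: "integrable lborel (\<lambda>x. g (x - v)) \<longleftrightarrow> integrable lborel g"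
proof -
  have [measurable]: "((+) (- v)) \<in> lborel \<rightarrow>\<^sub>M borel" by simp
  show "(\<integral>x. g (x - v) \<partial>lborel) = (\<integral>x. g x \<partial>lborel)"
    by (subst (2) lborel_distr_plus[of "-v", symmetric], subst integral_distr) simp_all
  show "integrable lborel (\<lambda>x. g (x - v)) \<longleftrightarrow> integrable lborel g"
    by (subst (2) lborel_distr_plus[of "-v", symmetric], subst integrable_distr_eq) simp_all
qed

lemma
  fixes g :: "'a::euclidean_space \<Rightarrow> 'b::{banach, second_countable_topology}"
  assumes [measurable]: "g \<in> borel_measurable borel" and c: "c \<noteq> 0"
  shows integral_lborel_scale: "(\<integral>x. g x \<partial>lborel) = \<bar>c\<bar> ^ DIM('a) *\<^sub>R (\<integral>x. g (c *\<^sub>R x) \<partial>lborel)"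
    and integrable_lborel_scale: "integrable lborel (\<lambda>x. g (c *\<^sub>R x)) \<longleftrightarrow> integrable lborel g"
proof -
  have eq: "(lborel :: 'a measure) = density (distr lborel borel (\<lambda>x. c *\<^sub>R x)) (\<lambda>_. ennreal (\<bar>c\<bar> ^ DIM('a)))"
    using lborel_affine[OF c, of 0] by (simp add: ennreal_power)
  show "(\<integral>x. g x \<partial>lborel) = \<bar>c\<bar> ^ DIM('a) *\<^sub>R (\<integral>x. g (c *\<^sub>R x) \<partial>lborel)"
    by (subst eq, subst integral_density) (simp_all add: integral_distr)
  show "integrable lborel (\<lambda>x. g (c *\<^sub>R x)) \<longleftrightarrow> integrable lborel g"
  proof -
    have "integrable lborel g \<longleftrightarrow> integrable lborel (\<lambda>x. \<bar>c\<bar> ^ DIM('a) *\<^sub>R g (c *\<^sub>R x))"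
      by (subst eq, subst integrable_density) (simp_all add: integrable_distr_eq)
    also have "\<dots> \<longleftrightarrow> integrable lborel (\<lambda>x. g (c *\<^sub>R x))"
    proof
      assume "integrable lborel (\<lambda>x. \<bar>c\<bar> ^ DIM('a) *\<^sub>R g (c *\<^sub>R x))"
      then have "integrable lborel (\<lambda>x. inverse (\<bar>c\<bar> ^ DIM('a)) *\<^sub>R \<bar>c\<bar> ^ DIM('a) *\<^sub>R g (c *\<^sub>R x))"
        by (rule integrable_scaleR_right)
      then show "integrable lborel (\<lambda>x. g (c *\<^sub>R x))" using c by simp
    qed simp
    finally show ?thesis ..
  qed
qed

section \<open>Fourier transform of integrable functions\<close>

lemma fourier_measurable [measurable]:
  assumes [measurable]: "h \<in> borel_measurable borel"
  shows "fourier h \<in> borel_measurable borel"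
  unfolding fourier_def by measurable

lemma norm_fourier_le: "norm (fourier h w) \<le> (\<integral>x. norm (h x) \<partial>lborel)"
proof -
  have "norm (fourier h w) \<le> (\<integral>x. norm (cis (- (x \<bullet> w)) * h x) \<partial>lborel)"
    unfolding fourier_def by (rule integral_norm_bound)
  then show ?thesis by (simp add: norm_mult)
qed

text \<open>Fubini, since the phase has modulus 1 and is symmetric in \<open>v\<close> and
  \<open>w\<close>. It moves the transform from the autocorrelation to a Gaussian, where it is
  explicit.\<close>

lemma fourier_multiplication:
  fixes g h :: "'a::euclidean_space \<Rightarrow> complex"
  assumes h: "integrable lborel h" and g: "integrable lborel g"
  shows "(\<integral>w. fourier h w * g w \<partial>lborel) = (\<integral>v. h v * fourier g v \<partial>lborel)"
proof -
  have [measurable]: "h \<in> borel_measurable borel" "g \<in> borel_measurable borel"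
    using assms[THEN borel_measurable_integrable] by simp_all
  have int: "integrable (lborel \<Otimes>\<^sub>M lborel) (\<lambda>(v, w). cis (- (v \<bullet> w)) * h v * g w)"
    by (rule lborel_pair.Fubini_integrable)
       (auto simp: norm_mult h intro!: AE_I2 integrable_mult_left integrable_norm
          Bochner_Integration.integrable_bound[OF integrable_mult_right[OF g]])
  have "(\<integral>w. fourier h w * g w \<partial>lborel) = (\<integral>w. (\<integral>v. cis (- (v \<bullet> w)) * h v * g w \<partial>lborel) \<partial>lborel)"
    by (simp add: fourier_def)
  also have "\<dots> = (\<integral>v. (\<integral>w. cis (- (v \<bullet> w)) * h v * g w \<partial>lborel) \<partial>lborel)"
    by (rule lborel_pair.Fubini_integral[OF int])
  also have "\<dots> = (\<integral>v. (\<integral>w. h v * (cis (- (w \<bullet> v)) * g w) \<partial>lborel) \<partial>lborel)"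
    by (simp add: mult_ac inner_commute)
  also have "\<dots> = (\<integral>v. h v * fourier g v \<partial>lborel)"
    by (simp add: fourier_def)
  finally show ?thesis .
qed

lemma cnj_measurable [measurable]: "cnj \<in> borel_measurable borel"
  by (intro borel_measurable_continuous_onI continuous_intros)

text \<open>The convolution of \<open>h\<close> with x \<mapsto> cnj (h (- x)).\<close>

definition autocorrelation :: "('a::euclidean_space \<Rightarrow> complex) \<Rightarrow> 'a \<Rightarrow> complex" where
  "autocorrelation h v = (\<integral>x. h x * cnj (h (x - v)) \<partial>lborel)"

lemma autocorrelation_measurable [measurable]:
  assumes [measurable]: "h \<in> borel_measurable borel"
  shows "autocorrelation h \<in> borel_measurable borel"
  unfolding autocorrelation_def by measurable

text \<open>The double integral of |h(x)| |h(x - v)| is the square of the L^1 norm, so Fubini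
  applies. Writing v = x - (x - v) in the phase separates the variables, and the reflection v
  \<mapsto> x - v produces the conjugate transform.\<close>

lemma
  assumes h: "integrable lborel h"
  shows integrable_autocorrelation: "integrable lborel (autocorrelation h)"
    and fourier_autocorrelation: "fourier (autocorrelation h) w = of_real ((norm (fourier h w))\<^sup>2)"
proof -
  have [measurable]: "h \<in> borel_measurable borel"
    using assms[THEN borel_measurable_integrable] by simp
  have hn: "integrable lborel (\<lambda>x. norm (h x))" using h by simp
  have int: "integrable (lborel \<Otimes>\<^sub>M lborel) (\<lambda>(x, v). h x * cnj (h (x - v)))"
  proof (rule lborel_pair.Fubini_integrable)
    have "(\<integral>v. norm (h (x - v)) \<partial>lborel) = (\<integral>v. norm (h v) \<partial>lborel)" for x
      by (rule integral_lborel_reflection[where g="\<lambda>x. norm (h x)"]) simp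
    then show "integrable lborel (\<lambda>x. \<integral>v. norm (case (x, v) of (x, v) \<Rightarrow> h x * cnj (h (x - v))) \<partial>lborel)"
      using hn by (simp add: norm_mult)
    have "integrable lborel (\<lambda>v. cnj (h (x - v)))" for x
      using h by (subst integrable_lborel_reflection[where g="\<lambda>x. cnj (h x)"]) simp_all
    then show "AE x in lborel. integrable lborel (\<lambda>v. case (x, v) of (x, v) \<Rightarrow> h x * cnj (h (x - v)))"
      by simp
  qed measurable
  show "integrable lborel (autocorrelation h)"
    using lborel_pair.integrable_snd[OF int] by (simp add: autocorrelation_def[abs_def])
  have int': "integrable (lborel \<Otimes>\<^sub>M lborel) (\<lambda>(x, v). cis (- (v \<bullet> w)) * (h x * cnj (h (x - v))))"
    by (rule Bochner_Integration.integrable_bound[OF int]) (auto simp: norm_mult)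
  have inner: "(\<integral>v. cis (- (v \<bullet> w)) * (h x * cnj (h (x - v))) \<partial>lborel) = cnj (fourier h w) * (cis (- (x \<bullet> w)) * h x)" for x
  proof -
    have c: "cis (- (x \<bullet> w)) * cis ((x - v) \<bullet> w) = cis (- (v \<bullet> w))" for v
      by (simp add: cis_mult inner_diff_left)
    have "(\<integral>v. cis (- (v \<bullet> w)) * (h x * cnj (h (x - v))) \<partial>lborel)
        = (\<integral>v. (cis (- (x \<bullet> w)) * h x) * (cis ((x - v) \<bullet> w) * cnj (h (x - v))) \<partial>lborel)"
      by (subst c[symmetric]) (simp only: mult_ac)
    also have "\<dots> = cis (- (x \<bullet> w)) * h x * (\<integral>v. cis ((x - v) \<bullet> w) * cnj (h (x - v)) \<partial>lborel)"
      by simp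
    also have "(\<integral>v. cis ((x - v) \<bullet> w) * cnj (h (x - v)) \<partial>lborel) = (\<integral>v. cis (v \<bullet> w) * cnj (h v) \<partial>lborel)"
      by (rule integral_lborel_reflection[where g="\<lambda>v. cis (v \<bullet> w) * cnj (h v)"]) simp
    also have "\<dots> = cnj (fourier h w)"
      unfolding fourier_def by (subst Bochner_Integration.integral_cnj[symmetric]) (simp add: cis_cnj)
    finally show ?thesis by (simp add: mult_ac)
  qed
  have "fourier (autocorrelation h) w = (\<integral>v. (\<integral>x. cis (- (v \<bullet> w)) * (h x * cnj (h (x - v))) \<partial>lborel) \<partial>lborel)"
    by (simp add: fourier_def autocorrelation_def)
  also have "\<dots> = (\<integral>x. (\<integral>v. cis (- (v \<bullet> w)) * (h x * cnj (h (x - v))) \<partial>lborel) \<partial>lborel)"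
    by (rule lborel_pair.Fubini_integral[OF int'])
  also have "\<dots> = (\<integral>x. cnj (fourier h w) * (cis (- (x \<bullet> w)) * h x) \<partial>lborel)"
    by (simp only: inner)
  also have "\<dots> = cnj (fourier h w) * fourier h w"
    by (simp add: fourier_def)
  also have "\<dots> = of_real ((norm (fourier h w))\<^sup>2)"
    by (simp only: complex_norm_square mult.commute)
  finally show "fourier (autocorrelation h) w = of_real ((norm (fourier h w))\<^sup>2)" .
qed

text \<open>AM-GM replaces Cauchy-Schwarz at no loss, since both factors have the same L^2 norm. The
  bound is uniform in \<open>v\<close> and supplies the dominating function for the limit e ->
  0.\<close>

lemma
  assumes [measurable]: "h \<in> borel_measurable borel" and h2: "integrable lborel (\<lambda>x. (norm (h x))\<^sup>2)"
  shows integrable_autocorrelation_integrand: "integrable lborel (\<lambda>x. h x * cnj (h (x - v)))"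
    and norm_autocorrelation_le: "norm (autocorrelation h v) \<le> (\<integral>x. (norm (h x))\<^sup>2 \<partial>lborel)"
proof -
  have h2': "integrable lborel (\<lambda>x. (norm (h (x - v)))\<^sup>2)"
    using h2 integrable_lborel_translation[where g="\<lambda>x. (norm (h x))\<^sup>2" and v=v] by simp
  have am: "norm (h x * cnj (h (x - v))) \<le> ((norm (h x))\<^sup>2 + (norm (h (x - v)))\<^sup>2) / 2" for x
    using sum_squares_bound[of "norm (h x)" "norm (h (x - v))"] by (simp add: norm_mult)
  have ir: "integrable lborel (\<lambda>x. ((norm (h x))\<^sup>2 + (norm (h (x - v)))\<^sup>2) / 2)"
    using h2 h2' by simp
  show i: "integrable lborel (\<lambda>x. h x * cnj (h (x - v)))"
    by (rule Bochner_Integration.integrable_bound[OF ir]) (use am in \<open>auto intro!: AE_I2 order_trans[OF am]\<close>)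
  have "norm (autocorrelation h v) \<le> (\<integral>x. ((norm (h x))\<^sup>2 + (norm (h (x - v)))\<^sup>2) / 2 \<partial>lborel)"
    unfolding autocorrelation_def by (rule Bochner_Integration.integral_norm_bound_integral[OF i ir]) (rule am)
  also have "\<dots> = ((\<integral>x. (norm (h x))\<^sup>2 \<partial>lborel) + (\<integral>x. (norm (h (x - v)))\<^sup>2 \<partial>lborel)) / 2"
    using h2 h2' by simp
  also have "(\<integral>x. (norm (h (x - v)))\<^sup>2 \<partial>lborel) = (\<integral>x. (norm (h x))\<^sup>2 \<partial>lborel)"
    by (rule integral_lborel_translation[where g="\<lambda>x. (norm (h x))\<^sup>2"]) simp
  finally show "norm (autocorrelation h v) \<le> (\<integral>x. (norm (h x))\<^sup>2 \<partial>lborel)" by simp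
qed

lemma autocorrelation_0: "autocorrelation h 0 = of_real (\<integral>x. (norm (h x))\<^sup>2 \<partial>lborel)"
  by (simp only: autocorrelation_def complex_norm_square diff_zero flip: integral_complex_of_real)

section \<open>The Plancherel identity\<close>

text \<open>
  Writing \<open>h = h\<^sub>N + (h - h\<^sub>N)\<close> with \<open>h\<^sub>N\<close> cut off at height \<open>N\<close>, the bounded part is controlled
  by continuity of translation in \<open>L\<^sup>1\<close>, the rest by the weighted AM-GM inequality; this
  avoids continuity of translation in \<open>L\<^sup>2\<close>.
\<close>

lemma autocorrelation_continuous_0:
  assumes h: "integrable lborel h" and h2: "integrable lborel (\<lambda>x. (norm (h x))\<^sup>2)" and v: "v \<longlonglongrightarrow> 0"
  shows "(\<lambda>n. autocorrelation h (v n)) \<longlonglongrightarrow> autocorrelation h 0"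
proof -
  have [measurable]: "h \<in> borel_measurable borel"
    using h[THEN borel_measurable_integrable] by simp
  define K where "K = (\<integral>x. (norm (h x))\<^sup>2 \<partial>lborel)"
  have K: "K \<ge> 0" by (simp add: K_def)
  \<comment> \<open>Squared tail of \<open>h\<close> above height \<open>N\<close>. Only this tail
    enters the estimate; the truncated function itself is never formed.\<close>
  define b where "b N x = (if norm (h x) > real N then (norm (h x))\<^sup>2 else 0)" for N x
  define D where "D n = (\<integral>x. norm (h (x - v n) - h x) \<partial>lborel)" for n
  have [measurable]: "b N \<in> borel_measurable borel" for N unfolding b_def by measurable
  have t2: "integrable lborel (\<lambda>x. (norm (h (x - w)))\<^sup>2)" for w
    using h2 by (subst integrable_lborel_translation[where g="\<lambda>x. (norm (h x))\<^sup>2"]) simp_all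
  have t2K: "(\<integral>x. (norm (h (x - w)))\<^sup>2 \<partial>lborel) = K" for w
    unfolding K_def by (rule integral_lborel_translation[where g="\<lambda>x. (norm (h x))\<^sup>2"]) simp
  have t1: "integrable lborel (\<lambda>x. norm (h (x - w) - h x))" for w
    using h integrable_lborel_translation[where g=h and v=w] by auto
  have ib: "integrable lborel (b N)" for N
    by (rule Bochner_Integration.integrable_bound[OF h2]) (auto simp: b_def)
  have b0: "(\<lambda>N. \<integral>x. b N x \<partial>lborel) \<longlonglongrightarrow> (\<integral>x. 0 \<partial>(lborel :: 'a measure))"
  proof (rule integral_dominated_convergence[OF _ _ h2])
    show "AE x in lborel. (\<lambda>N. b N x) \<longlonglongrightarrow> 0"
    proof (rule AE_I2)
      fix x
      obtain M :: nat where M: "norm (h x) \<le> real M" using real_arch_simple by blast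
      have "eventually (\<lambda>N. b N x = 0) sequentially"
        using eventually_ge_at_top[of M] by eventually_elim (use M in \<open>auto simp: b_def\<close>)
      then show "(\<lambda>N. b N x) \<longlonglongrightarrow> 0" by (rule tendsto_eventually)
    qed
  qed (auto simp: b_def)
  have D0: "D \<longlonglongrightarrow> 0"
  proof -
    have "(\<lambda>n. ennreal (D n)) \<longlonglongrightarrow> 0"
      using translation_continuous_L1[OF h v] t1
      by (simp add: D_def nn_integral_eq_integral)
    then show ?thesis by (subst (asm) ennreal_tendsto_0_iff) (auto simp: D_def)
  qed
  \<comment> \<open>The weight \<open>s\<close> and the height \<open>N\<close> stay free:
    \<open>s\<close> is fixed first, then \<open>N\<close> depending on \<open>s\<close>, because
    the tail is divided by \<open>s\<close>; \<open>n\<close> comes last.\<close>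
  have bound: "norm (autocorrelation h (v n) - autocorrelation h 0)
      \<le> real N * D n + s * K + (\<integral>x. b N x \<partial>lborel) / s" if "s > 0" for n N s
  proof -
    have i: "integrable lborel (\<lambda>x. real N * norm (h (x - v n) - h x) + (s / 2 * (norm (h (x - v n)))\<^sup>2 + s / 2 * (norm (h x))\<^sup>2 + b N x / s))"
      using t1 t2 h2 ib by simp
    have "autocorrelation h (v n) - autocorrelation h 0 = (\<integral>x. h x * cnj (h (x - v n)) - h x * cnj (h (x - 0)) \<partial>lborel)"
      unfolding autocorrelation_def
      by (rule Bochner_Integration.integral_diff[symmetric]; rule integrable_autocorrelation_integrand) (simp_all add: h2)
    also have "norm \<dots> \<le> (\<integral>x. real N * norm (h (x - v n) - h x) + (s / 2 * (norm (h (x - v n)))\<^sup>2 + s / 2 * (norm (h x))\<^sup>2 + b N x / s) \<partial>lborel)"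
    proof (rule Bochner_Integration.integral_norm_bound_integral[OF _ i])
      fix x
      define p where "p = norm (h x)"
      define q where "q = norm (h (x - v n))"
      define r where "r = norm (h (x - v n) - h x)"
      have pq: "p \<ge> 0" "q \<ge> 0" "r \<ge> 0" "r \<le> q + p"
        unfolding p_def q_def r_def by (auto intro: norm_triangle_ineq4)
      have "norm (h x * cnj (h (x - v n)) - h x * cnj (h (x - 0))) = norm (h x * cnj (h (x - v n) - h x))"
        by (simp add: right_diff_distrib)
      also have "\<dots> = p * r" by (simp only: norm_mult complex_mod_cnj p_def r_def)
      also have "p * r \<le> real N * r + (s / 2 * q\<^sup>2 + s / 2 * p\<^sup>2 + b N x / s)"
      proof (cases "p > real N")
        case True
        \<comment> \<open>Expansion of (s t - p)^2 / (2 s) \<ge> 0. Used with \<open>t = q\<close>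
          and \<open>t = p\<close>, so that two halves of p^2 / s add up.\<close>
        have am: "p * t \<le> s / 2 * t\<^sup>2 + p\<^sup>2 / s / 2" for t
        proof -
          have "0 \<le> (s * t - p)\<^sup>2 / (2 * s)" using \<open>s > 0\<close> by simp
          then show ?thesis using \<open>s > 0\<close> by (simp add: field_simps power2_eq_square)
        qed
        have "p * r \<le> p * (q + p)" using pq by (intro mult_left_mono)
        also have "\<dots> \<le> s / 2 * q\<^sup>2 + s / 2 * p\<^sup>2 + p\<^sup>2 / s"
          using am[of q] am[of p] by (simp add: distrib_left)
        also have "\<dots> \<le> real N * r + (s / 2 * q\<^sup>2 + s / 2 * p\<^sup>2 + b N x / s)"
          using True pq by (simp add: b_def p_def)
        finally show ?thesis .
      next
        case False
        then have "p * r \<le> real N * r" using pq by (intro mult_right_mono) auto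
        moreover have "0 \<le> s / 2 * q\<^sup>2 + s / 2 * p\<^sup>2 + b N x / s"
          using \<open>s > 0\<close> by (auto simp: b_def intro!: add_nonneg_nonneg)
        ultimately show ?thesis by linarith
      qed
      finally show "norm (h x * cnj (h (x - v n)) - h x * cnj (h (x - 0))) \<le> real N * norm (h (x - v n) - h x) + (s / 2 * (norm (h (x - v n)))\<^sup>2 + s / 2 * (norm (h x))\<^sup>2 + b N x / s)"
        by (simp only: p_def q_def r_def)
    qed (intro Bochner_Integration.integrable_diff integrable_autocorrelation_integrand h2; simp)
    also have "\<dots> = real N * D n + (s / 2 * K + s / 2 * K + (\<integral>x. b N x \<partial>lborel) / s)"
      using t1 t2 t2[of 0] h2 ib t2K[of "v n"] by (simp add: D_def K_def)
    finally show ?thesis by (simp add: algebra_simps)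
  qed
  show ?thesis
  proof (rule LIMSEQ_I)
    fix e :: real assume e: "e > 0"
    \<comment> \<open>Chosen to give \<open>s * K < e / 3\<close>; the summand 1 covers
      \<open>K = 0\<close>.\<close>
    define s where "s = e / (3 * (K + 1))"
    have s: "s > 0" "s * K < e / 3" using e K by (auto simp: s_def field_simps)
    have "eventually (\<lambda>N. (\<integral>x. b N x \<partial>lborel) < s * (e / 3)) sequentially"
      using b0 e s by (intro order_tendstoD(2)) auto
    then obtain N where N: "(\<integral>x. b N x \<partial>lborel) < s * (e / 3)"
      by (auto simp: eventually_sequentially)
    then have N': "(\<integral>x. b N x \<partial>lborel) / s < e / 3"
      using s by (simp add: field_simps)
    have "(\<lambda>n. real N * D n) \<longlonglongrightarrow> real N * 0" by (intro tendsto_intros D0)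
    then have "eventually (\<lambda>n. real N * D n < e / 3) sequentially"
      using e by (intro order_tendstoD(2)) auto
    then have "eventually (\<lambda>n. norm (autocorrelation h (v n) - autocorrelation h 0) < e) sequentially"
    proof eventually_elim
      case (elim n)
      then show ?case using bound[OF s(1), of n N] s(2) N' by linarith
    qed
    then show "\<exists>no. \<forall>n\<ge>no. norm (autocorrelation h (v n) - autocorrelation h 0) < e"
      by (simp add: eventually_sequentially)
  qed
qed

text \<open>The transform of the dilated Gaussian carries e^(-n), which the Jacobian of v = e u
  cancels; no power of \<open>e\<close> is left to disturb the limit.\<close>

lemma gauss_smoothed_plancherel:
  fixes h :: "'a::euclidean_space \<Rightarrow> complex"
  assumes h: "integrable lborel h" and e: "e > 0"
  shows "of_real (\<integral>w. (norm (fourier h w))\<^sup>2 * gauss (e *\<^sub>R w) \<partial>lborel) =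
    sqrt (2 * pi) ^ DIM('a) *\<^sub>R (\<integral>u. autocorrelation h (e *\<^sub>R u) * of_real (gauss u) \<partial>lborel)"
proof -
  have [measurable]: "h \<in> borel_measurable borel"
    using h[THEN borel_measurable_integrable] by simp
  let ?g = "\<lambda>w::'a. complex_of_real (gauss (e *\<^sub>R w))"
  have "integrable lborel (\<lambda>w::'a. gauss (e *\<^sub>R w))"
    using e integrable_gauss by (subst integrable_lborel_scale) auto
  then have ig: "integrable lborel ?g" by simp
  have fg: "\<bar>e\<bar> ^ DIM('a) *\<^sub>R fourier ?g (e *\<^sub>R u) = of_real (sqrt (2 * pi) ^ DIM('a) * gauss u)" for u
  proof -
    have "fourier (\<lambda>x. of_real (gauss x)) u = \<bar>e\<bar> ^ DIM('a) *\<^sub>R fourier ?g (e *\<^sub>R u)"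
      unfolding fourier_def using e by (subst integral_lborel_scale[of _ e]) auto
    then show ?thesis by (simp add: fourier_gauss)
  qed
  have "of_real (\<integral>w. (norm (fourier h w))\<^sup>2 * gauss (e *\<^sub>R w) \<partial>lborel) = (\<integral>w. fourier (autocorrelation h) w * ?g w \<partial>lborel)"
    by (simp add: fourier_autocorrelation[OF h] flip: integral_complex_of_real)
  also have "\<dots> = (\<integral>v. autocorrelation h v * fourier ?g v \<partial>lborel)"
    by (rule fourier_multiplication[OF integrable_autocorrelation[OF h] ig])
  also have "\<dots> = \<bar>e\<bar> ^ DIM('a) *\<^sub>R (\<integral>u. autocorrelation h (e *\<^sub>R u) * fourier ?g (e *\<^sub>R u) \<partial>lborel)"
    using e by (subst integral_lborel_scale[of _ e]) auto
  also have "\<dots> = (\<integral>u. autocorrelation h (e *\<^sub>R u) * (\<bar>e\<bar> ^ DIM('a) *\<^sub>R fourier ?g (e *\<^sub>R u)) \<partial>lborel)"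
    by (simp flip: integral_scaleR_right)
  also have "\<dots> = (\<integral>u. sqrt (2 * pi) ^ DIM('a) *\<^sub>R (autocorrelation h (e *\<^sub>R u) * of_real (gauss u)) \<partial>lborel)"
    by (simp only: fg) (simp add: scaleR_conv_of_real mult_ac)
  also have "\<dots> = sqrt (2 * pi) ^ DIM('a) *\<^sub>R (\<integral>u. autocorrelation h (e *\<^sub>R u) * of_real (gauss u) \<partial>lborel)"
    by (rule integral_scaleR_right)
  finally show ?thesis .
qed

theorem plancherel:
  fixes h :: "'a::euclidean_space \<Rightarrow> complex"
  assumes h: "integrable lborel h" and h2: "integrable lborel (\<lambda>x. (norm (h x))\<^sup>2)"
  shows "(\<integral>\<^sup>+w. ennreal ((norm (fourier h w))\<^sup>2) \<partial>lborel) =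
    ennreal ((2 * pi) ^ DIM('a) * (\<integral>x. (norm (h x))\<^sup>2 \<partial>lborel))"
proof -
  have [measurable]: "h \<in> borel_measurable borel"
    using h[THEN borel_measurable_integrable] by simp
  define K where "K = (\<integral>x. (norm (h x))\<^sup>2 \<partial>lborel)"
  define e where "e n = inverse (real (Suc n))" for n
  have e: "e n > 0" for n by (simp add: e_def)
  have e0: "e \<longlonglongrightarrow> 0" unfolding e_def[abs_def] by (rule LIMSEQ_inverse_real_of_nat)
  define I where "I n = (\<integral>w. (norm (fourier h w))\<^sup>2 * gauss (e n *\<^sub>R w) \<partial>lborel)" for n
  \<comment> \<open>\<open>fourier h\<close> is bounded by the L^1 norm of \<open>h\<close>, so the
    Gaussian weight alone ensures integrability.\<close>
  have int: "integrable lborel (\<lambda>w. (norm (fourier h w))\<^sup>2 * gauss (e n *\<^sub>R w))" for n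
  proof (rule Bochner_Integration.integrable_bound)
    show "integrable lborel (\<lambda>w::'a. (\<integral>x. norm (h x) \<partial>lborel)\<^sup>2 * gauss (e n *\<^sub>R w))"
      using e[of n] integrable_gauss by (intro integrable_mult_right, subst integrable_lborel_scale) auto
    show "AE w in lborel. norm ((norm (fourier h w))\<^sup>2 * gauss (e n *\<^sub>R w)) \<le> norm ((\<integral>x. norm (h x) \<partial>lborel)\<^sup>2 * gauss (e n *\<^sub>R w))"
      by (intro AE_I2) (auto simp: abs_mult gauss_nonneg intro!: mult_right_mono power_mono norm_fourier_le)
  qed measurable
  have "(\<lambda>n. \<integral>\<^sup>+w. ennreal ((norm (fourier h w))\<^sup>2 * gauss (e n *\<^sub>R w)) \<partial>lborel) \<longlonglongrightarrow> (\<integral>\<^sup>+w. ennreal ((norm (fourier h w))\<^sup>2) \<partial>lborel)"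
  proof (rule nn_integral_LIMSEQ)
    show "incseq (\<lambda>n w. ennreal ((norm (fourier h w))\<^sup>2 * gauss (e n *\<^sub>R w)))"
      unfolding incseq_def le_fun_def
    proof (intro allI impI ennreal_leI mult_left_mono)
      fix m n :: nat and w :: 'a assume "m \<le> n"
      then have "e n \<le> e m" by (simp add: e_def)
      then have "norm (e n *\<^sub>R w) \<le> norm (e m *\<^sub>R w)" using e[of n] e[of m] by (simp add: mult_right_mono)
      then show "gauss (e m *\<^sub>R w) \<le> gauss (e n *\<^sub>R w)" unfolding gauss_def by (simp add: power_mono del: norm_scaleR)
    qed simp
    show "(\<lambda>n. ennreal ((norm (fourier h w))\<^sup>2 * gauss (e n *\<^sub>R w))) \<longlonglongrightarrow> ennreal ((norm (fourier h w))\<^sup>2)" for w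
    proof (rule tendsto_ennrealI)
      have "(\<lambda>n. (norm (fourier h w))\<^sup>2 * gauss (e n *\<^sub>R w)) \<longlonglongrightarrow> (norm (fourier h w))\<^sup>2 * gauss (0 *\<^sub>R w)"
        unfolding gauss_def by (intro tendsto_intros e0) simp
      then show "(\<lambda>n. (norm (fourier h w))\<^sup>2 * gauss (e n *\<^sub>R w)) \<longlonglongrightarrow> (norm (fourier h w))\<^sup>2" by simp
    qed
  qed measurable
  then have lim1: "(\<lambda>n. ennreal (I n)) \<longlonglongrightarrow> (\<integral>\<^sup>+w. ennreal ((norm (fourier h w))\<^sup>2) \<partial>lborel)"
    unfolding I_def using int by (simp add: nn_integral_eq_integral gauss_nonneg)
  have "(\<lambda>n. \<integral>u. autocorrelation h (e n *\<^sub>R u) * of_real (gauss u) \<partial>lborel) \<longlonglongrightarrow> (\<integral>u. autocorrelation h 0 * of_real (gauss u) \<partial>(lborel :: 'a measure))"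
  proof (rule integral_dominated_convergence[where w="\<lambda>u. K * gauss u"])
    show "integrable lborel (\<lambda>u::'a. K * gauss u)" by (intro integrable_mult_right integrable_gauss)
    show "AE u in lborel. (\<lambda>n. autocorrelation h (e n *\<^sub>R u) * of_real (gauss u)) \<longlonglongrightarrow> autocorrelation h 0 * of_real (gauss u)"
    proof (intro AE_I2 tendsto_intros autocorrelation_continuous_0 h h2)
      fix u :: 'a
      have "(\<lambda>n. e n *\<^sub>R u) \<longlonglongrightarrow> 0 *\<^sub>R u" by (intro tendsto_intros e0)
      then show "(\<lambda>n. e n *\<^sub>R u) \<longlonglongrightarrow> 0" by simp
    qed
    show "AE u in lborel. norm (autocorrelation h (e n *\<^sub>R u) * of_real (gauss u)) \<le> K * gauss u" for n
      using norm_autocorrelation_le[OF _ h2] by (auto simp: norm_mult gauss_nonneg K_def intro!: mult_right_mono)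
  qed measurable
  also have "(\<integral>u. autocorrelation h 0 * of_real (gauss u) \<partial>(lborel :: 'a measure)) = of_real (K * sqrt (2 * pi) ^ DIM('a))"
    using integral_gauss[where 'a='a] by (simp add: autocorrelation_0 K_def)
  finally have "(\<lambda>n. sqrt (2 * pi) ^ DIM('a) *\<^sub>R (\<integral>u. autocorrelation h (e n *\<^sub>R u) * of_real (gauss u) \<partial>lborel)) \<longlonglongrightarrow> sqrt (2 * pi) ^ DIM('a) *\<^sub>R of_real (K * sqrt (2 * pi) ^ DIM('a))"
    by (intro tendsto_intros)
  then have "(\<lambda>n. complex_of_real (I n)) \<longlonglongrightarrow> sqrt (2 * pi) ^ DIM('a) *\<^sub>R of_real (K * sqrt (2 * pi) ^ DIM('a))"
    unfolding I_def gauss_smoothed_plancherel[OF h e] .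
  \<comment> \<open>One factor \<open>sqrt (2 * pi) ^ DIM('a)\<close> is the Fourier constant of the
    Gaussian, the other its mass.\<close>
  also have "sqrt (2 * pi) ^ DIM('a) *\<^sub>R of_real (K * sqrt (2 * pi) ^ DIM('a)) = complex_of_real ((2 * pi) ^ DIM('a) * K)"
  proof -
    have sq: "sqrt (2 * pi) ^ DIM('a) * sqrt (2 * pi) ^ DIM('a) = (2 * pi) ^ DIM('a)"
      by (subst power_mult_distrib[symmetric]) simp
    show ?thesis
      unfolding scaleR_conv_of_real of_real_mult[symmetric] sq[symmetric] by (simp only: mult_ac)
  qed
  finally have "I \<longlonglongrightarrow> (2 * pi) ^ DIM('a) * K"
    by (simp only: tendsto_of_real_iff)
  then have "(\<lambda>n. ennreal (I n)) \<longlonglongrightarrow> ennreal ((2 * pi) ^ DIM('a) * K)"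
    by (rule tendsto_ennrealI)
  with lim1 show ?thesis
    unfolding K_def by (rule LIMSEQ_unique)
qed

section \<open>The quaternionic linear canonical transform\<close>

text \<open>
  The map \<open>q \<mapsto> i q j\<close> is an involution whose eigenspaces are \<open>C (1 + k)\<close> and \<open>C (1 - k)\<close>
  with \<open>C = \<real> + \<real>i\<close>; \<open>qz\<close> and \<open>qw\<close> are the coordinates in
  \<open>q = z (1 + k) + w (1 - k)\<close>. On the eigenspaces right multiplication by \<open>j\<close> is left
  multiplication by \<open>-i\<close> and by \<open>i\<close>, respectively.
\<close>

definition qz :: "quat \<Rightarrow> complex" where
  "qz q = Complex ((qRe q + qIm3 q) / 2) ((qIm1 q - qIm2 q) / 2)"

definition qw :: "quat \<Rightarrow> complex" where
  "qw q = Complex ((qRe q - qIm3 q) / 2) ((qIm1 q + qIm2 q) / 2)"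

lemma bounded_linear_qz: "bounded_linear qz" and bounded_linear_qw: "bounded_linear qw"
  unfolding linear_conv_bounded_linear[symmetric]
  by (intro linearI; simp add: qz_def qw_def complex_eq_iff field_simps)+

text \<open>The eigenspaces are orthogonal because q \<mapsto> i q j is an isometric involution; the
  factor 2 is |1 + k|^2 = |1 - k|^2.\<close>

lemma norm_quat_qz_qw: "(norm q)\<^sup>2 = 2 * ((cmod (qz q))\<^sup>2 + (cmod (qw q))\<^sup>2)"
  by (simp add: norm_quat_def qz_def qw_def cmod_power2) (simp add: power2_eq_square field_simps)

lemma quat_of_complex_sel [simp]:
  "qRe (quat_of_complex quat_i z) = Re z" "qIm1 (quat_of_complex quat_i z) = Im z"
  "qIm2 (quat_of_complex quat_i z) = 0" "qIm3 (quat_of_complex quat_i z) = 0"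
  "qRe (quat_of_complex quat_j z) = Re z" "qIm1 (quat_of_complex quat_j z) = 0"
  "qIm2 (quat_of_complex quat_j z) = Im z" "qIm3 (quat_of_complex quat_j z) = 0"
  by (simp_all add: quat_of_complex_def of_real_def)

text \<open>Right multiplication by an element of \<real> + \<real>j with complex coordinate w is
  multiplication by cnj w on the first eigenspace and by w on the second. Hence the two kernel
  phases are subtracted in \<open>qz\<close> and added in \<open>qw\<close>.\<close>

lemma qz_two_sided: "qz (quat_of_complex quat_i z * q * quat_of_complex quat_j w) = z * cnj w * qz q"
  and qw_two_sided: "qw (quat_of_complex quat_i z * q * quat_of_complex quat_j w) = z * w * qw q"
  by (simp_all add: qz_def qw_def complex_eq_iff field_simps)

section \<open>The kernels as complex numbers inside \<real> + \<real>\<mu>\<close>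

lemma bounded_linear_quat_of_complex: "bounded_linear (quat_of_complex \<mu>)"
  unfolding linear_conv_bounded_linear[symmetric]
  by (intro linearI) (simp_all add: quat_of_complex_def of_real_def algebra_simps)

lemma quat_of_complex_power:
  assumes "\<mu> * \<mu> = -1"
  shows "quat_of_complex \<mu> (z ^ n) = quat_of_complex \<mu> z ^ n"
proof (induction n)
  case 0
  show ?case by (simp add: quat_of_complex_def)
next
  case (Suc n)
  then show ?case by (simp add: quat_of_complex_mult[OF assms])
qed

text \<open>\<open>quat_of_complex \<mu>\<close> is multiplicative and bounded linear, so it can be
  applied termwise to the exponential series.\<close>

lemma exp_scaleR_quat_unit:
  assumes "\<mu> * \<mu> = -1"
  shows "exp (t *\<^sub>R \<mu>) = quat_of_complex \<mu> (cis t)"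
proof -
  interpret bounded_linear "quat_of_complex \<mu>" by (rule bounded_linear_quat_of_complex)
  have i: "quat_of_complex \<mu> (\<i> * of_real t) = t *\<^sub>R \<mu>"
    by (simp add: quat_of_complex_def)
  have "quat_of_complex \<mu> (cis t) = quat_of_complex \<mu> (\<Sum>n. (\<i> * of_real t) ^ n /\<^sub>R fact n)"
    by (simp add: cis_conv_exp exp_def)
  also have "\<dots> = (\<Sum>n. quat_of_complex \<mu> ((\<i> * of_real t) ^ n /\<^sub>R fact n))"
    by (rule suminf[OF summable_exp_generic])
  also have "\<dots> = exp (t *\<^sub>R \<mu>)"
    by (simp add: exp_def scaleR quat_of_complex_power[OF assms] i)
  finally show ?thesis ..
qed

definition lct_phase :: "real^2^2 \<Rightarrow> real \<Rightarrow> real \<Rightarrow> real" where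
  "lct_phase A x \<omega> = (A$1$1 / A$1$2 * x\<^sup>2 - 2 / A$1$2 * x * \<omega> + A$2$2 / A$1$2 * \<omega>\<^sup>2 - pi / 2) / 2"

definition lct_factor :: "real^2^2 \<Rightarrow> complex" where
  "lct_factor A = 1 / csqrt (complex_of_real (2 * pi * A$1$2))"

lemma lct_kernel_eq:
  assumes "\<mu> * \<mu> = -1"
  shows "lct_kernel \<mu> A x \<omega> = quat_of_complex \<mu> (lct_factor A * cis (lct_phase A x \<omega>))"
  unfolding lct_kernel_def Let_def lct_factor_def lct_phase_def quat_of_complex_mult[OF assms]
  by (subst exp_scaleR_quat_unit[OF assms]) (rule refl)

text \<open>Only the modulus of the principal root enters, so the sign of the radicand leaves
  nothing but an absolute value.\<close>

lemma norm_lct_factor: "(cmod (lct_factor A))\<^sup>2 = 1 / (2 * pi * \<bar>A$1$2\<bar>)"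
  by (simp add: lct_factor_def norm_divide power_divide norm_csqrt norm_mult abs_mult)

lemma nn_integral_lborel_diagonal:
  fixes g :: "real^'n \<Rightarrow> ennreal" and c :: "'n \<Rightarrow> real"
  assumes [measurable]: "g \<in> borel_measurable borel" and c: "\<And>i. c i \<noteq> 0"
  shows "(\<integral>\<^sup>+x. g x \<partial>lborel) = ennreal (\<Prod>i\<in>UNIV. \<bar>c i\<bar>) * (\<integral>\<^sup>+x. g (\<chi> i. c i * x $ i) \<partial>lborel)"
proof -
  \<comment> \<open>Reindexes the coefficients from coordinates to basis vectors; the choice inverts
    the injective map i \<mapsto> \<open>axis i 1\<close>.\<close>
  define d where "d b = c (SOME i. b = axis i (1::real))" for b :: "real^'n"
  have d: "d (axis i 1) = c i" for i
    unfolding d_def by (rule arg_cong[where f=c]) (auto simp: axis_eq_axis)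
  have B: "(Basis :: (real^'n) set) = (\<lambda>i. axis i 1) ` UNIV" by (auto simp: Basis_vec_def)
  have inj: "inj (\<lambda>i. axis i (1::real) :: real^'n)" by (auto simp: inj_on_def axis_eq_axis)
  have T: "0 + (\<Sum>j\<in>Basis. (d j * (x \<bullet> j)) *\<^sub>R j) = (\<chi> i. c i * x $ i)" for x
    unfolding B by (subst sum.reindex[OF inj])
      (simp add: d inner_axis, simp add: vec_eq_iff axis_def if_distrib cong: if_cong)
  have P: "(\<Prod>j\<in>Basis. \<bar>d j\<bar>) = (\<Prod>i\<in>UNIV. \<bar>c i\<bar>)"
    unfolding B by (subst prod.reindex[OF inj]) (simp add: d)
  have L: "(lborel :: (real^'n) measure) = density (distr lborel borel (\<lambda>x. \<chi> i. c i * x $ i)) (\<lambda>_. ennreal (\<Prod>i\<in>UNIV. \<bar>c i\<bar>))"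
  proof -
    have "d j \<noteq> 0" if "j \<in> Basis" for j using that c by (auto simp: B d)
    then show ?thesis by (rule lborel_affine_euclidean[of d 0, unfolded T P])
  qed
  have [measurable]: "(\<lambda>x. \<chi> i. c i * x $ i) \<in> borel \<rightarrow>\<^sub>M (borel :: (real^'n) measure)"
    by (intro borel_measurable_continuous_onI continuous_intros)
  show ?thesis
    by (subst L, subst nn_integral_density) (simp_all add: nn_integral_distr nn_integral_cmult)
qed

lemma chirp_plancherel:
  fixes h :: "real^2 \<Rightarrow> complex" and \<alpha> \<beta> :: "real^2 \<Rightarrow> real"
  assumes h: "integrable lborel h" and h2: "integrable lborel (\<lambda>x. (cmod (h x))\<^sup>2)"
    and [measurable]: "\<alpha> \<in> borel_measurable borel" and b: "b\<^sub>1 \<noteq> 0" "b\<^sub>2 \<noteq> 0"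
  shows "(\<integral>\<^sup>+\<omega>. ennreal ((cmod (\<integral>x. cis (\<alpha> x + \<beta> \<omega> - (x$1 * \<omega>$1 / b\<^sub>1 + x$2 * \<omega>$2 / b\<^sub>2)) * h x \<partial>lborel))\<^sup>2) \<partial>lborel)
     = ennreal ((2 * pi)\<^sup>2 * \<bar>b\<^sub>1 * b\<^sub>2\<bar> * (\<integral>x. (cmod (h x))\<^sup>2 \<partial>lborel))"
proof -
  have [measurable]: "h \<in> borel_measurable borel"
    using h[THEN borel_measurable_integrable] by simp
  define c :: "2 \<Rightarrow> real" where "c i = (if i = 1 then 1 / b\<^sub>1 else 1 / b\<^sub>2)" for i
  define H where "H x = cis (\<alpha> x) * h x" for x
  have [measurable]: "H \<in> borel_measurable borel" unfolding H_def by measurable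
  have H: "integrable lborel H"
    by (rule Bochner_Integration.integrable_bound[OF h]) (auto simp: H_def norm_mult)
  have cH: "cmod (H x) = cmod (h x)" for x by (simp add: H_def norm_mult)
  have eq: "cmod (\<integral>x. cis (\<alpha> x + \<beta> \<omega> - (x$1 * \<omega>$1 / b\<^sub>1 + x$2 * \<omega>$2 / b\<^sub>2)) * h x \<partial>lborel) = cmod (fourier H (\<chi> i. c i * \<omega> $ i))" for \<omega>
  proof -
    have "(\<integral>x. cis (\<alpha> x + \<beta> \<omega> - (x$1 * \<omega>$1 / b\<^sub>1 + x$2 * \<omega>$2 / b\<^sub>2)) * h x \<partial>lborel)
       = (\<integral>x. cis (\<beta> \<omega>) * (cis (- (x \<bullet> (\<chi> i. c i * \<omega> $ i))) * H x) \<partial>lborel)"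
      by (intro Bochner_Integration.integral_cong)
         (auto simp: H_def inner_vec_def sum_2 c_def cis_mult algebra_simps)
    also have "\<dots> = cis (\<beta> \<omega>) * fourier H (\<chi> i. c i * \<omega> $ i)"
      by (simp add: fourier_def)
    finally show ?thesis by (simp add: norm_mult)
  qed
  have "ennreal ((2 * pi)\<^sup>2 * (\<integral>x. (cmod (h x))\<^sup>2 \<partial>lborel)) = (\<integral>\<^sup>+w. ennreal ((cmod (fourier H w))\<^sup>2) \<partial>lborel)"
    using plancherel[OF H] h2 by (simp add: cH)
  also have "\<dots> = ennreal (\<Prod>i\<in>UNIV. \<bar>c i\<bar>) * (\<integral>\<^sup>+w. ennreal ((cmod (fourier H (\<chi> i. c i * w $ i)))\<^sup>2) \<partial>lborel)"
    using b by (intro nn_integral_lborel_diagonal) (auto simp: c_def)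
  also have "(\<Prod>i\<in>UNIV. \<bar>c i\<bar>) = 1 / \<bar>b\<^sub>1 * b\<^sub>2\<bar>"
    by (simp add: UNIV_2 c_def abs_mult)
  \<comment> \<open>Multiplication by |b1 b2| cancels the Jacobian without a division in
    \<open>ennreal\<close>.\<close>
  finally have "ennreal \<bar>b\<^sub>1 * b\<^sub>2\<bar> * ennreal ((2 * pi)\<^sup>2 * (\<integral>x. (cmod (h x))\<^sup>2 \<partial>lborel)) =
     ennreal \<bar>b\<^sub>1 * b\<^sub>2\<bar> * (ennreal (1 / \<bar>b\<^sub>1 * b\<^sub>2\<bar>) * (\<integral>\<^sup>+w. ennreal ((cmod (fourier H (\<chi> i. c i * w $ i)))\<^sup>2) \<partial>lborel))"
    by simp
  also have "\<dots> = (\<integral>\<^sup>+w. ennreal ((cmod (fourier H (\<chi> i. c i * w $ i)))\<^sup>2) \<partial>lborel)"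
    using b by (simp flip: mult.assoc ennreal_mult)
  finally show ?thesis
    unfolding eq by (simp add: mult_ac flip: ennreal_mult)
qed

lemma integrable_norm_square_bounded_linear:
  assumes "bounded_linear T" and [measurable]: "h \<in> borel_measurable M"
    and "integrable M (\<lambda>x. (norm (h x))\<^sup>2)"
  shows "integrable M (\<lambda>x. (norm (T (h x) :: 'b::{real_normed_vector,second_countable_topology}))\<^sup>2)"
proof -
  interpret bounded_linear T by fact
  obtain K where K: "norm (T x) \<le> norm x * K" for x using bounded by blast
  have [measurable]: "T \<in> borel_measurable borel" 
    by (intro borel_measurable_continuous_onI linear_continuous_on assms)
  show ?thesis
  proof (rule Bochner_Integration.integrable_bound)
    show "integrable M (\<lambda>x. K\<^sup>2 * (norm (h x))\<^sup>2)" using assms by simp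
    show "AE x in M. norm ((norm (T (h x)))\<^sup>2) \<le> norm (K\<^sup>2 * (norm (h x))\<^sup>2)"
    proof (rule AE_I2)
      fix x
      have "(norm (T (h x)))\<^sup>2 \<le> (norm (h x) * K)\<^sup>2" by (intro power_mono K) simp
      then show "norm ((norm (T (h x)))\<^sup>2) \<le> norm (K\<^sup>2 * (norm (h x))\<^sup>2)" by (simp add: power_mult_distrib mult.commute)
    qed
  qed measurable
qed

lemma quat_of_complex_measurable [measurable]: "quat_of_complex \<mu> \<in> borel_measurable borel"
  by (intro borel_measurable_continuous_onI linear_continuous_on bounded_linear_quat_of_complex)

lemma vec_nth_measurable [measurable]: "(\<lambda>x::real^'n. x $ i) \<in> borel_measurable borel"
  by (intro borel_measurable_continuous_onI continuous_intros)

lemma lct_phase_measurable [measurable]: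
  assumes [measurable]: "f \<in> borel_measurable M" "g \<in> borel_measurable M"
  shows "(\<lambda>x. lct_phase A (f x) (g x)) \<in> borel_measurable M"
  unfolding lct_phase_def by measurable

theorem qlct_plancherel:
  fixes h :: "real^2 \<Rightarrow> quat"
  assumes h: "integrable lborel h" and h2: "integrable lborel (\<lambda>x. (norm (h x))\<^sup>2)"
    and b: "A\<^sub>1$1$2 \<noteq> 0" "A\<^sub>2$1$2 \<noteq> 0"
  shows "(\<integral>\<^sup>+\<omega>. ennreal ((norm (\<integral>x. lct_kernel quat_i A\<^sub>1 (x$1) (\<omega>$1) * h x * lct_kernel quat_j A\<^sub>2 (x$2) (\<omega>$2) \<partial>lborel))\<^sup>2) \<partial>(lborel :: (real^2) measure))
     = ennreal (\<integral>x. (norm (h x))\<^sup>2 \<partial>lborel)"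
proof -
  have [measurable]: "h \<in> borel_measurable borel"
    using h[THEN borel_measurable_integrable] by simp
  define I where "I \<omega> x = lct_kernel quat_i A\<^sub>1 (x$1) (\<omega>$1) * h x * lct_kernel quat_j A\<^sub>2 (x$2) (\<omega>$2)" for \<omega> x :: "real^2"
  define Q where "Q \<omega> = (\<integral>x. I \<omega> x \<partial>lborel)" for \<omega>
  let ?p = "\<lambda>(x :: real^2) (\<omega> :: real^2). lct_phase A\<^sub>1 (x$1) (\<omega>$1)" and ?q = "\<lambda>(x :: real^2) (\<omega> :: real^2). lct_phase A\<^sub>2 (x$2) (\<omega>$2)"
  let ?s = "lct_factor A\<^sub>1" and ?t = "lct_factor A\<^sub>2"
  have I: "I \<omega> x = quat_of_complex quat_i (?s * cis (?p x \<omega>)) * h x * quat_of_complex quat_j (?t * cis (?q x \<omega>))" for \<omega> x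
    by (simp only: I_def lct_kernel_eq quat_unit_mult(1,2))
  have nq: "norm (quat_of_complex quat_i z) = cmod z" "norm (quat_of_complex quat_j z) = cmod z" for z
    by (simp_all add: norm_quat_def cmod_def)
  have "(\<lambda>x. I \<omega> x) \<in> borel_measurable borel" for \<omega>
    unfolding I by measurable
  then have [measurable]: "I \<omega> \<in> borel_measurable borel" for \<omega> .
  have int: "integrable lborel (I \<omega>)" for \<omega>
  proof (rule Bochner_Integration.integrable_bound)
    show "integrable lborel (\<lambda>x. cmod ?s * cmod ?t * norm (h x))" using h by simp
  qed (auto simp: I norm_quat_mult nq norm_mult)
  have z: "qz (Q \<omega>) = (\<integral>x. ?s * cnj ?t * (cis (?p x \<omega> - ?q x \<omega>) * qz (h x)) \<partial>lborel)" for \<omega>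
  proof -
    have "qz (Q \<omega>) = (\<integral>x. qz (I \<omega> x) \<partial>lborel)"
      unfolding Q_def by (rule integral_bounded_linear[OF bounded_linear_qz int, symmetric])
    also have "\<dots> = (\<integral>x. (?s * cis (?p x \<omega>)) * cnj (?t * cis (?q x \<omega>)) * qz (h x) \<partial>lborel)"
      by (simp only: I qz_two_sided)
    moreover have "cis (a - b) = cis a * cis (- b)" for a b by (simp add: cis_mult)
    ultimately show ?thesis by (simp only: complex_cnj_mult cis_cnj mult_ac)
  qed
  have w: "qw (Q \<omega>) = (\<integral>x. ?s * ?t * (cis (?p x \<omega> + ?q x \<omega>) * qw (h x)) \<partial>lborel)" for \<omega>
  proof -
    have "qw (Q \<omega>) = (\<integral>x. qw (I \<omega> x) \<partial>lborel)"
      unfolding Q_def by (rule integral_bounded_linear[OF bounded_linear_qw int, symmetric])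
    also have "\<dots> = (\<integral>x. (?s * cis (?p x \<omega>)) * (?t * cis (?q x \<omega>)) * qw (h x) \<partial>lborel)"
      by (simp only: I qw_two_sided)
    finally show ?thesis by (simp only: cis_mult[symmetric] mult_ac)
  qed
  have c: "(cmod ?s)\<^sup>2 * (cmod ?t)\<^sup>2 * ((2 * pi)\<^sup>2 * \<bar>A\<^sub>1$1$2 * A\<^sub>2$1$2\<bar>) = 1"
    unfolding norm_lct_factor using b by (simp add: power2_eq_square abs_mult)
  define \<alpha> where "\<alpha> A x = A$1$1 / A$1$2 * x\<^sup>2 / 2" for A :: "real^2^2" and x
  define \<beta> where "\<beta> A x = A$2$2 / A$1$2 * x\<^sup>2 / 2 - pi / 4" for A :: "real^2^2" and x
  \<comment> \<open>The phase splits into a chirp in \<open>x\<close>, a chirp in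
    \<open>\<omega>\<close> and the bilinear Fourier term; the constant -pi/2, halved, sits in
    \<open>\<beta>\<close>.\<close>
  have ph: "lct_phase A x \<omega> = \<alpha> A x + \<beta> A \<omega> - x * \<omega> / A$1$2" for A x \<omega>
    by (simp add: lct_phase_def \<alpha>_def \<beta>_def diff_divide_distrib add_divide_distrib)
  have iz: "integrable lborel (\<lambda>x. qz (h x))" and iw: "integrable lborel (\<lambda>x. qw (h x))"
    by (intro integrable_bounded_linear[OF bounded_linear_qz] integrable_bounded_linear[OF bounded_linear_qw] h)+
  have iz2: "integrable lborel (\<lambda>x. (cmod (qz (h x)))\<^sup>2)" and iw2: "integrable lborel (\<lambda>x. (cmod (qw (h x)))\<^sup>2)"
    using integrable_norm_square_bounded_linear[OF bounded_linear_qz _ h2]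
      integrable_norm_square_bounded_linear[OF bounded_linear_qw _ h2] by simp_all
  have [measurable]: "(\<lambda>x. \<alpha> A (x$i)) \<in> borel_measurable borel" for A and i :: 2
    unfolding \<alpha>_def by measurable
  have [measurable]: "qz \<in> borel_measurable borel" "qw \<in> borel_measurable borel"
    by (intro borel_measurable_continuous_onI linear_continuous_on bounded_linear_qz bounded_linear_qw)+
  have Z: "(\<integral>\<^sup>+\<omega>. ennreal ((cmod (qz (Q \<omega>)))\<^sup>2) \<partial>lborel) = ennreal (\<integral>x. (cmod (qz (h x)))\<^sup>2 \<partial>lborel)"
  proof -
    have "(\<integral>\<^sup>+\<omega>. ennreal ((cmod (\<integral>x. cis (?p x \<omega> - ?q x \<omega>) * qz (h x) \<partial>lborel))\<^sup>2) \<partial>lborel)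
       = ennreal ((2 * pi)\<^sup>2 * \<bar>A\<^sub>1$1$2 * (- A\<^sub>2$1$2)\<bar> * (\<integral>x. (cmod (qz (h x)))\<^sup>2 \<partial>lborel))"
      \<comment> \<open>The second parameter is \<open>- A\<^sub>2$1$2\<close> since the second
        phase is subtracted here; only its absolute value survives in the result.\<close>
      using chirp_plancherel[OF iz iz2, of "\<lambda>x. \<alpha> A\<^sub>1 (x$1) - \<alpha> A\<^sub>2 (x$2)" "A\<^sub>1$1$2" "- A\<^sub>2$1$2" "\<lambda>x. \<beta> A\<^sub>1 (x$1) - \<beta> A\<^sub>2 (x$2)"] b
      by (simp add: ph algebra_simps)
    note * = this
    have "(\<integral>\<^sup>+\<omega>. ennreal ((cmod (qz (Q \<omega>)))\<^sup>2) \<partial>lborel) = (\<integral>\<^sup>+\<omega>. ennreal ((cmod ?s)\<^sup>2 * (cmod ?t)\<^sup>2) * ennreal ((cmod (\<integral>x. cis (?p x \<omega> - ?q x \<omega>) * qz (h x) \<partial>lborel))\<^sup>2) \<partial>lborel)"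
      unfolding z by (simp add: norm_mult power_mult_distrib ennreal_mult)
    also have "\<dots> = ennreal ((cmod ?s)\<^sup>2 * (cmod ?t)\<^sup>2) * (\<integral>\<^sup>+\<omega>. ennreal ((cmod (\<integral>x. cis (?p x \<omega> - ?q x \<omega>) * qz (h x) \<partial>lborel))\<^sup>2) \<partial>lborel)"
      by (rule nn_integral_cmult) measurable
    also have "\<dots> = ennreal (((cmod ?s)\<^sup>2 * (cmod ?t)\<^sup>2 * ((2 * pi)\<^sup>2 * \<bar>A\<^sub>1$1$2 * A\<^sub>2$1$2\<bar>)) * (\<integral>x. (cmod (qz (h x)))\<^sup>2 \<partial>lborel))"
      unfolding * by (simp add: mult.assoc flip: ennreal_mult)
    finally show ?thesis unfolding c by simp
  qed
  have W: "(\<integral>\<^sup>+\<omega>. ennreal ((cmod (qw (Q \<omega>)))\<^sup>2) \<partial>lborel) = ennreal (\<integral>x. (cmod (qw (h x)))\<^sup>2 \<partial>lborel)"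
  proof -
    have "(\<integral>\<^sup>+\<omega>. ennreal ((cmod (\<integral>x. cis (?p x \<omega> + ?q x \<omega>) * qw (h x) \<partial>lborel))\<^sup>2) \<partial>lborel)
       = ennreal ((2 * pi)\<^sup>2 * \<bar>A\<^sub>1$1$2 * A\<^sub>2$1$2\<bar> * (\<integral>x. (cmod (qw (h x)))\<^sup>2 \<partial>lborel))"
      using chirp_plancherel[OF iw iw2, of "\<lambda>x. \<alpha> A\<^sub>1 (x$1) + \<alpha> A\<^sub>2 (x$2)" "A\<^sub>1$1$2" "A\<^sub>2$1$2" "\<lambda>x. \<beta> A\<^sub>1 (x$1) + \<beta> A\<^sub>2 (x$2)"] b
      by (simp add: ph algebra_simps)
    note * = this
    have "(\<integral>\<^sup>+\<omega>. ennreal ((cmod (qw (Q \<omega>)))\<^sup>2) \<partial>lborel) = (\<integral>\<^sup>+\<omega>. ennreal ((cmod ?s)\<^sup>2 * (cmod ?t)\<^sup>2) * ennreal ((cmod (\<integral>x. cis (?p x \<omega> + ?q x \<omega>) * qw (h x) \<partial>lborel))\<^sup>2) \<partial>lborel)"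
      unfolding w by (simp add: norm_mult power_mult_distrib ennreal_mult)
    also have "\<dots> = ennreal ((cmod ?s)\<^sup>2 * (cmod ?t)\<^sup>2) * (\<integral>\<^sup>+\<omega>. ennreal ((cmod (\<integral>x. cis (?p x \<omega> + ?q x \<omega>) * qw (h x) \<partial>lborel))\<^sup>2) \<partial>lborel)"
      by (rule nn_integral_cmult) measurable
    also have "\<dots> = ennreal (((cmod ?s)\<^sup>2 * (cmod ?t)\<^sup>2 * ((2 * pi)\<^sup>2 * \<bar>A\<^sub>1$1$2 * A\<^sub>2$1$2\<bar>)) * (\<integral>x. (cmod (qw (h x)))\<^sup>2 \<partial>lborel))"
      unfolding * by (simp add: mult.assoc flip: ennreal_mult)
    finally show ?thesis unfolding c by simp
  qed
  have [measurable]: "Q \<in> borel_measurable borel"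
    unfolding Q_def I by measurable
  have "(\<integral>\<^sup>+\<omega>. ennreal ((norm (Q \<omega>))\<^sup>2) \<partial>lborel)
     = (\<integral>\<^sup>+\<omega>. 2 * (ennreal ((cmod (qz (Q \<omega>)))\<^sup>2) + ennreal ((cmod (qw (Q \<omega>)))\<^sup>2)) \<partial>lborel)"
    by (intro nn_integral_cong) (simp add: norm_quat_qz_qw ennreal_mult ennreal_plus)
  also have "\<dots> = 2 * (ennreal (\<integral>x. (cmod (qz (h x)))\<^sup>2 \<partial>lborel) + ennreal (\<integral>x. (cmod (qw (h x)))\<^sup>2 \<partial>lborel))"
    by (simp add: nn_integral_cmult nn_integral_add Z W)
  also have "\<dots> = ennreal (\<integral>x. (norm (h x))\<^sup>2 \<partial>lborel)"
    using iz2 iw2 by (simp add: norm_quat_qz_qw ennreal_mult ennreal_plus)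
  finally show ?thesis by (simp only: Q_def I_def)
qed

section \<open>The Gabor transform\<close>

text \<open>Subsets of null sets are measurable for the completion, so a change on a null set is
  harmless. This is applied to the Gabor integrand, which is only almost everywhere equal to a Borel
  function.\<close>

lemma completion_measurable_AE_cong:
  assumes g: "g \<in> completion M \<rightarrow>\<^sub>M N" and ae: "AE x in M. f x = g x" and sp: "\<And>x. x \<in> space M \<Longrightarrow> f x \<in> space N"
  shows "f \<in> completion M \<rightarrow>\<^sub>M N"
proof -
  show ?thesis
  proof (rule measurableI)
    fix A assume A: "A \<in> sets N"
    show "f -` A \<inter> space (completion M) \<in> sets (completion M)"
    proof (rule completion.in_sets_AE[OF _ measurable_sets[OF g A]])
      show "AE x in completion M. x \<in> g -` A \<inter> space (completion M) \<longleftrightarrow> x \<in> f -` A \<inter> space (completion M)"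
        using AE_completion[OF ae] by eventually_elim auto
    qed simp
  qed (use sp in simp)
qed

text \<open>Each real coordinate has a representative, and the exceptional sets over the finite
  basis combine into one null set.\<close>

lemma completion_ex_borel_measurable_euclidean:
  fixes f :: "'a \<Rightarrow> 'b::euclidean_space"
  assumes f: "f \<in> borel_measurable (completion M)"
  obtains g where "g \<in> borel_measurable M" "AE x in M. f x = g x"
proof -
  have "\<exists>g\<in>borel_measurable M. AE x in M. f x \<bullet> b = g x" for b
    using f by (intro completion_ex_borel_measurable_real) simp
  then obtain g where g: "g b \<in> borel_measurable M" "AE x in M. f x \<bullet> b = g b x" for b
    by metis
  show ?thesis
  proof
    show "(\<lambda>x. \<Sum>b\<in>Basis. g b x *\<^sub>R b) \<in> borel_measurable M" using g(1) by measurable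
    have "AE x in M. \<forall>b\<in>Basis. f x \<bullet> b = g b x" by (intro AE_finite_allI g) simp
    then show "AE x in M. f x = (\<Sum>b\<in>Basis. g b x *\<^sub>R b)"
      by eventually_elim (metis (no_types, lifting) euclidean_representation sum.cong)
  qed
qed

lemma AE_lborel_translation:
  fixes v :: "'a::euclidean_space"
  assumes "AE x in lborel. P x"
  shows "AE x in lborel. P (x - v)"
proof -
  obtain N where N: "N \<in> null_sets lborel" "\<And>x. \<not> P x \<Longrightarrow> x \<in> N"
    using assms by (auto simp: eventually_ae_filter)
  show ?thesis
    by (rule AE_I'[OF null_sets_translation[OF N(1), of v]]) (use N(2) in auto)
qed

lemma norm_qcnj [simp]: "norm (qcnj q) = norm q"
  by (simp add: norm_quat_def)

lemma qcnj_measurable [measurable]: "qcnj \<in> borel_measurable borel"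
proof -
  have "bounded_linear qcnj"
    unfolding linear_conv_bounded_linear[symmetric] by (intro linearI) (simp_all add: quat_eq_iff)
  then show ?thesis by (intro borel_measurable_continuous_onI linear_continuous_on)
qed

text \<open>The norm is recorded as a nonnegative integral of the representative over
  \<open>lborel\<close>, the form in which Tonelli uses it.\<close>

lemma L2_quat_borel_representative:
  assumes "f \<in> L2_quat"
  obtains F where "F \<in> borel_measurable borel" "AE x in lborel. f x = F x"
    "(\<integral>\<^sup>+x. ennreal ((norm (F x))\<^sup>2) \<partial>lborel) = ennreal ((L2_norm_quat f)\<^sup>2)"
proof -
  obtain F where F: "F \<in> borel_measurable lborel" "AE x in lborel. f x = F x"
    using assms completion_ex_borel_measurable_euclidean[of f lborel] by (auto simp: L2_quat_def)
  have "(\<integral>\<^sup>+x. ennreal ((norm (F x))\<^sup>2) \<partial>lborel) = (\<integral>\<^sup>+x. ennreal ((norm (f x))\<^sup>2) \<partial>lborel)"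
    using F(2) by (intro nn_integral_cong_AE) (auto elim!: eventually_mono)
  also have "\<dots> = (\<integral>\<^sup>+x. ennreal ((norm (f x))\<^sup>2) \<partial>lebesgue)"
    by (simp add: nn_integral_completion)
  also have "\<dots> = ennreal (\<integral>x. (norm (f x))\<^sup>2 \<partial>lebesgue)"
    using assms by (intro nn_integral_eq_integral) (auto simp: L2_quat_def)
  also have "\<dots> = ennreal ((L2_norm_quat f)\<^sup>2)"
    by (simp add: L2_norm_quat_def)
  finally show ?thesis using F by (intro that) auto
qed

text \<open>Tonelli, then invariance under y \<mapsto> x - y. For squared moduli it yields both the
  product of the norms and finiteness of the inner integral for almost every
  \<open>y\<close>.\<close>

lemma nn_integral_correlation:
  fixes f g :: "'a::euclidean_space \<Rightarrow> ennreal"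
  assumes [measurable]: "f \<in> borel_measurable borel" "g \<in> borel_measurable borel"
  shows "(\<integral>\<^sup>+y. (\<integral>\<^sup>+x. f x * g (x - y) \<partial>lborel) \<partial>lborel) = (\<integral>\<^sup>+x. f x \<partial>lborel) * (\<integral>\<^sup>+x. g x \<partial>lborel)"
proof -
  have r: "(\<integral>\<^sup>+y. g (x - y) \<partial>lborel) = (\<integral>\<^sup>+y. g y \<partial>lborel)" for x
  proof -
    have "(\<integral>\<^sup>+y. g y \<partial>distr lborel borel (\<lambda>y. x - y)) = (\<integral>\<^sup>+y. g (x - y) \<partial>lborel)"
      by (rule nn_integral_distr) simp_all
    then show ?thesis by (simp add: lborel_distr_reflection)
  qed
  have "(\<integral>\<^sup>+y. (\<integral>\<^sup>+x. f x * g (x - y) \<partial>lborel) \<partial>lborel) = (\<integral>\<^sup>+x. (\<integral>\<^sup>+y. f x * g (x - y) \<partial>lborel) \<partial>lborel)"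
    by (rule lborel_pair.Fubini') measurable
  also have "\<dots> = (\<integral>\<^sup>+x. f x * (\<integral>\<^sup>+y. g y \<partial>lborel) \<partial>lborel)"
    by (intro nn_integral_cong) (subst nn_integral_cmult, simp_all add: r)
  also have "\<dots> = (\<integral>\<^sup>+x. f x \<partial>lborel) * (\<integral>\<^sup>+x. g x \<partial>lborel)"
    by (rule nn_integral_multc) simp
  finally show ?thesis .
qed

lemma lct_kernel_measurable:
  assumes "\<mu> * \<mu> = -1" and [measurable]: "f \<in> borel_measurable M" "g \<in> borel_measurable M"
  shows "(\<lambda>x. lct_kernel \<mu> A (f x) (g x)) \<in> borel_measurable M"
  unfolding lct_kernel_eq[OF assms(1)] by measurable

lemmas lct_kernel_ij_measurable [measurable] =
  lct_kernel_measurable[OF quat_unit_mult(1)] lct_kernel_measurable[OF quat_unit_mult(2)]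

text \<open>Valid for every \<omega> and y, not merely almost every: for fixed y the exceptional set
  lies in the union of a null set and a translate of another.\<close>

lemma gabor_qlct_borel_representative:
  assumes [measurable]: "F \<in> borel_measurable borel" "P \<in> borel_measurable borel"
    and F: "AE x in lborel. f x = F x" and P: "AE x in lborel. \<phi> x = P x"
  shows "gabor_qlct A\<^sub>1 A\<^sub>2 \<phi> f \<omega> y =
    (\<integral>x. lct_kernel quat_i A\<^sub>1 (x$1) (\<omega>$1) * (F x * qcnj (P (x - y))) * lct_kernel quat_j A\<^sub>2 (x$2) (\<omega>$2) \<partial>lborel)"
proof -
  let ?I = "\<lambda>x. lct_kernel quat_i A\<^sub>1 (x$1) (\<omega>$1) * f x * qcnj (\<phi> (x - y)) * lct_kernel quat_j A\<^sub>2 (x$2) (\<omega>$2)"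
  let ?J = "\<lambda>x. lct_kernel quat_i A\<^sub>1 (x$1) (\<omega>$1) * (F x * qcnj (P (x - y))) * lct_kernel quat_j A\<^sub>2 (x$2) (\<omega>$2)"
  have J: "?J \<in> borel_measurable lborel" by measurable
  have ae: "AE x in lborel. ?I x = ?J x"
    using F AE_lborel_translation[OF P, of y] by eventually_elim (simp add: mult.assoc)
  have "gabor_qlct A\<^sub>1 A\<^sub>2 \<phi> f \<omega> y = integral\<^sup>L lebesgue ?I" by (simp add: gabor_qlct_def)
  also have "\<dots> = integral\<^sup>L lebesgue ?J"
    using measurable_completion[OF J] ae
    by (intro integral_cong_AE completion_measurable_AE_cong[OF _ ae] AE_completion) auto
  also have "\<dots> = integral\<^sup>L lborel ?J" by (rule integral_completion[OF J])
  finally show ?thesis .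
qed

theorem theorem2p6:
  fixes A\<^sub>1 A\<^sub>2 :: "real^2^2" and f \<phi> :: "real^2 \<Rightarrow> quat"
  assumes "A\<^sub>1$1$1 * A\<^sub>1$2$2 - A\<^sub>1$1$2 * A\<^sub>1$2$1 = 1"
    and "A\<^sub>2$1$1 * A\<^sub>2$2$2 - A\<^sub>2$1$2 * A\<^sub>2$2$1 = 1"
    and "A\<^sub>1$1$2 * A\<^sub>2$1$2 \<noteq> 0"
    and "f \<in> L2_quat" and "\<phi> \<in> L2_quat"
  shows "(\<integral>\<^sup>+ y. (\<integral>\<^sup>+ \<omega>. ennreal ((norm (gabor_qlct A\<^sub>1 A\<^sub>2 \<phi> f \<omega> y))\<^sup>2) \<partial>lebesgue) \<partial>lebesgue)
       = ennreal ((L2_norm_quat f)\<^sup>2 * (L2_norm_quat \<phi>)\<^sup>2)"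
proof -
  obtain F where [measurable]: "F \<in> borel_measurable borel" and F: "AE x in lborel. f x = F x"
    "(\<integral>\<^sup>+x. ennreal ((norm (F x))\<^sup>2) \<partial>lborel) = ennreal ((L2_norm_quat f)\<^sup>2)"
    using L2_quat_borel_representative[OF \<open>f \<in> L2_quat\<close>] .
  obtain P where [measurable]: "P \<in> borel_measurable borel" and P: "AE x in lborel. \<phi> x = P x"
    "(\<integral>\<^sup>+x. ennreal ((norm (P x))\<^sup>2) \<partial>lborel) = ennreal ((L2_norm_quat \<phi>)\<^sup>2)"
    using L2_quat_borel_representative[OF \<open>\<phi> \<in> L2_quat\<close>] .
  define h where "h y x = F x * qcnj (P (x - y))" for y x
  have [measurable]: "h y \<in> borel_measurable borel" for y
    unfolding h_def by measurable
  have nh: "(norm (h y x))\<^sup>2 = (norm (F x))\<^sup>2 * (norm (P (x - y)))\<^sup>2" for x y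
    by (simp add: h_def norm_quat_mult power_mult_distrib)
  have iF: "integrable lborel (\<lambda>x. (norm (F x))\<^sup>2)" and iP: "integrable lborel (\<lambda>x. (norm (P x))\<^sup>2)"
    using F(2) P(2) by (auto intro!: integrableI_bounded)
  \<comment> \<open>Pointwise AM-GM gives an integrable bound for every \<open>y\<close>, with no
    exceptional set.\<close>
  have ih: "integrable lborel (h y)" for y
  proof (rule Bochner_Integration.integrable_bound)
    show "integrable lborel (\<lambda>x. (norm (F x))\<^sup>2 + (norm (P (x - y)))\<^sup>2)"
      using iF iP by (intro Bochner_Integration.integrable_add) (simp_all add: integrable_lborel_translation[where g="\<lambda>x. (norm (P x))\<^sup>2"])
    show "AE x in lborel. norm (h y x) \<le> norm ((norm (F x))\<^sup>2 + (norm (P (x - y)))\<^sup>2)"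
    proof (rule AE_I2)
      fix x
      have "norm (h y x) = norm (F x) * norm (P (x - y))" by (simp add: h_def norm_quat_mult)
      also have "\<dots> \<le> 2 * norm (F x) * norm (P (x - y))" by simp
      also have "\<dots> \<le> (norm (F x))\<^sup>2 + (norm (P (x - y)))\<^sup>2" by (rule sum_squares_bound)
      finally show "norm (h y x) \<le> norm ((norm (F x))\<^sup>2 + (norm (P (x - y)))\<^sup>2)" by simp
    qed
  qed simp
  define N where "N y = (\<integral>\<^sup>+x. ennreal ((norm (h y x))\<^sup>2) \<partial>lborel)" for y
  have [measurable]: "N \<in> borel_measurable borel"
    unfolding N_def h_def by measurable
  have "(\<integral>\<^sup>+y. N y \<partial>lborel) = (\<integral>\<^sup>+x. ennreal ((norm (F x))\<^sup>2) \<partial>lborel) * (\<integral>\<^sup>+x. ennreal ((norm (P x))\<^sup>2) \<partial>lborel)"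
    unfolding N_def nh by (simp add: ennreal_mult nn_integral_correlation[where g="\<lambda>x. ennreal ((norm (P x))\<^sup>2)"])
  then have N: "(\<integral>\<^sup>+y. N y \<partial>lborel) = ennreal ((L2_norm_quat f)\<^sup>2 * (L2_norm_quat \<phi>)\<^sup>2)"
    unfolding F P by (simp add: ennreal_mult)
  \<comment> \<open>The finite total integral leaves only a null set of \<open>y\<close> for which
    \<open>h y\<close> may fail to lie in L^2.\<close>
  have "AE y in lborel. N y \<noteq> \<infinity>"
    by (rule nn_integral_PInf_AE) (simp_all add: N)
  then have "AE y in lborel. (\<integral>\<^sup>+ \<omega>. ennreal ((norm (gabor_qlct A\<^sub>1 A\<^sub>2 \<phi> f \<omega> y))\<^sup>2) \<partial>lborel) = N y"
  proof eventually_elim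
    case (elim y)
    then have "integrable lborel (\<lambda>x. (norm (h y x))\<^sup>2)"
      by (intro integrableI_bounded) (auto simp: N_def top.not_eq_extremum)
    moreover from this have "N y = ennreal (\<integral>x. (norm (h y x))\<^sup>2 \<partial>lborel)"
      unfolding N_def by (intro nn_integral_eq_integral) auto
    ultimately show ?case
      using qlct_plancherel[OF ih[of y], of A\<^sub>1 A\<^sub>2] assms(3)
      by (simp add: gabor_qlct_borel_representative[OF _ _ F(1) P(1)] h_def)
  qed
  then have "(\<integral>\<^sup>+ y. (\<integral>\<^sup>+ \<omega>. ennreal ((norm (gabor_qlct A\<^sub>1 A\<^sub>2 \<phi> f \<omega> y))\<^sup>2) \<partial>lborel) \<partial>lborel) = (\<integral>\<^sup>+y. N y \<partial>lborel)"
    by (rule nn_integral_cong_AE)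
  \<comment> \<open>A nonnegative integral agrees for a measure and its completion whatever the
    integrand, so both passages from \<open>lebesgue\<close> to \<open>lborel\<close> are
    free.\<close>
  then show ?thesis
    by (simp only: nn_integral_completion N)
qed

end
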